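(* Let $X$ be a Banach space which admits an unconditional atomic decomposition $((x'_i),(x_i))$. Then $((x'_i),(x_i))$ is boundedly complete if and only if $X$ does not contain an isomorphic copy of $c_0$.
   Context: $X'$ and $X''$ denote the topological dual and bidual of $X$, and $\langle\cdot,\cdot\rangle$ the duality pairing. A Banach sequence space is a Banach space of scalar sequences indexed by $\mathbb N$ for which the coordinate functionals are continuous. Atomic decomposition: for sequences $(x'_i)\subset X'$ and $(x_i)\subset X$, the pair $((x'_i),(x_i))$ is an atomic decomposition of $X$ with respect to a Banach sequence space $Z$ if there are constants $A,B>0$ such that for all $x\in X$: (a) $(\langle x'_i,x\rangle)_i\in Z$; (b) $A\|x\|\le\|(\langle x'_i,x\rangle)_i\|_Z\le B\|x\|$; (c) $x=\sum_{i=1}^\infty\langle x'_i,x\rangle x_i$. It is an atomic decomposition of $X$ if this holds with respect to some Banach sequence space $Z$; it is unconditional if the series in (c) converges unconditionally for every $x\in X$. An atomic decomposition $((x'_i),(x_i))$ of $X$ is boundedly complete if for each $x''\in X''$ the series $\sum_{i=1}^\infty\langle x'',x'_i\rangle x_i$ converges in $X$. *)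

theory Defs
  imports "HOL-Analysis.Analysis"
begin

text \<open>
  The scalar field is \<open>\<real>\<close> or \<open>\<complex>\<close>. Both cases are treated at once: a type belongs to the
  following class iff it is isometrically isomorphic, as a field, to one of the two.
\<close>

class real_or_complex = real_normed_field +
  assumes ex_iso_real_or_complex:
    "\<exists>h :: 'a \<Rightarrow> complex.
        (\<forall>a b. h (a + b) = h a + h b) \<and> (\<forall>a b. h (a * b) = h a * h b) \<and> h 1 = 1 \<and>
        (\<forall>a. norm (h a) = norm a) \<and> (range h = \<real> \<or> range h = UNIV)"

instance real :: real_or_complex
proof
  show "\<exists>h :: real \<Rightarrow> complex.
        (\<forall>a b. h (a + b) = h a + h b) \<and> (\<forall>a b. h (a * b) = h a * h b) \<and> h 1 = 1 \<and>
        (\<forall>a. norm (h a) = norm a) \<and> (range h = \<real> \<or> range h = UNIV)"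
    by (rule exI[of _ complex_of_real]) (simp add: Reals_def)
qed

instance complex :: real_or_complex
proof
  show "\<exists>h :: complex \<Rightarrow> complex.
        (\<forall>a b. h (a + b) = h a + h b) \<and> (\<forall>a b. h (a * b) = h a * h b) \<and> h 1 = 1 \<and>
        (\<forall>a. norm (h a) = norm a) \<and> (range h = \<real> \<or> range h = UNIV)"
    by (rule exI[of _ "\<lambda>a. a"]) simp
qed

text \<open>
  A Banach space over \<open>'k\<close> is a type of class \<^class>\<open>banach\<close> together with a multiplication by
  scalars from \<open>'k\<close> that extends \<^const>\<open>scaleR\<close>.
\<close>

locale banach_space_over = vector_space smul
  for smul :: "'k::real_or_complex \<Rightarrow> 'a::banach \<Rightarrow> 'a" +
  assumes smul_of_real: "smul (of_real r) x = r *\<^sub>R x"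
    and norm_smul: "norm (smul c x) = norm c * norm x"

lemma banach_space_over_scaleR: "banach_space_over (scaleR :: real \<Rightarrow> 'a::banach \<Rightarrow> 'a)"
  by unfold_locales (simp_all add: scaleR_add_right scaleR_add_left)

lemma banach_space_over_mult: "banach_space_over ((*) :: complex \<Rightarrow> complex \<Rightarrow> complex)"
  by unfold_locales (auto simp: distrib_left distrib_right norm_mult scaleR_conv_of_real)

definition dual :: "('k::real_or_complex \<Rightarrow> 'a::banach \<Rightarrow> 'a) \<Rightarrow> ('a \<Rightarrow> 'k) set" where
  "dual smul = {f. bounded_linear f \<and> (\<forall>c x. f (smul c x) = c * f x)}"

text \<open>
  The dual is a set of functions, normed by \<^const>\<open>onorm\<close>; an element of the bidual is a function
  whose restriction to that set is linear and bounded. Its values off the dual are irrelevant.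
\<close>

definition bidual :: "('k::real_or_complex \<Rightarrow> 'a::banach \<Rightarrow> 'a) \<Rightarrow> (('a \<Rightarrow> 'k) \<Rightarrow> 'k) set" where
  "bidual smul = {\<phi>.
     (\<forall>f\<in>dual smul. \<forall>g\<in>dual smul. \<phi> (\<lambda>x. f x + g x) = \<phi> f + \<phi> g) \<and>
     (\<forall>c. \<forall>f\<in>dual smul. \<phi> (\<lambda>x. c * f x) = c * \<phi> f) \<and>
     (\<exists>C. \<forall>f\<in>dual smul. norm (\<phi> f) \<le> C * onorm f)}"

text \<open>
  A Banach sequence space is given by its set of sequences \<open>Z\<close> and its norm \<open>N\<close>, of which only
  the values on \<open>Z\<close> matter.
\<close>

definition banach_sequence_space ::
    "(nat \<Rightarrow> 'k::real_or_complex) set \<Rightarrow> ((nat \<Rightarrow> 'k) \<Rightarrow> real) \<Rightarrow> bool" where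
  "banach_sequence_space Z N \<longleftrightarrow>
     (\<lambda>i. 0) \<in> Z \<and>
     (\<forall>a\<in>Z. \<forall>b\<in>Z. (\<lambda>i. a i + b i) \<in> Z) \<and>
     (\<forall>c. \<forall>a\<in>Z. (\<lambda>i. c * a i) \<in> Z) \<and>
     (\<forall>a\<in>Z. 0 \<le> N a \<and> (N a = 0 \<longleftrightarrow> a = (\<lambda>i. 0))) \<and>
     (\<forall>a\<in>Z. \<forall>b\<in>Z. N (\<lambda>i. a i + b i) \<le> N a + N b) \<and>
     (\<forall>c. \<forall>a\<in>Z. N (\<lambda>i. c * a i) = norm c * N a) \<and>
     (\<forall>s :: nat \<Rightarrow> nat \<Rightarrow> 'k. (\<forall>n. s n \<in> Z) \<longrightarrow>
        (\<forall>e>0. \<exists>M. \<forall>m\<ge>M. \<forall>n\<ge>M. N (\<lambda>i. s m i - s n i) < e) \<longrightarrow>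
        (\<exists>a\<in>Z. (\<lambda>n. N (\<lambda>i. s n i - a i)) \<longlonglongrightarrow> 0)) \<and>
     (\<forall>i. \<exists>C. \<forall>a\<in>Z. norm (a i) \<le> C * N a)"

definition atomic_decomposition_wrt ::
    "('k::real_or_complex \<Rightarrow> 'a::banach \<Rightarrow> 'a) \<Rightarrow> (nat \<Rightarrow> 'k) set \<Rightarrow> ((nat \<Rightarrow> 'k) \<Rightarrow> real) \<Rightarrow>
     (nat \<Rightarrow> 'a \<Rightarrow> 'k) \<Rightarrow> (nat \<Rightarrow> 'a) \<Rightarrow> bool" where
  "atomic_decomposition_wrt smul Z N f u \<longleftrightarrow>
     (\<forall>i. f i \<in> dual smul) \<and>
     (\<exists>A>0. \<exists>B>0. \<forall>x.
        (\<lambda>i. f i x) \<in> Z \<and>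
        A * norm x \<le> N (\<lambda>i. f i x) \<and> N (\<lambda>i. f i x) \<le> B * norm x \<and>
        (\<lambda>i. smul (f i x) (u i)) sums x)"

definition atomic_decomposition ::
    "('k::real_or_complex \<Rightarrow> 'a::banach \<Rightarrow> 'a) \<Rightarrow> (nat \<Rightarrow> 'a \<Rightarrow> 'k) \<Rightarrow> (nat \<Rightarrow> 'a) \<Rightarrow> bool" where
  "atomic_decomposition smul f u \<longleftrightarrow>
     (\<exists>Z N. banach_sequence_space Z N \<and> atomic_decomposition_wrt smul Z N f u)"

definition unconditionally_summable :: "(nat \<Rightarrow> 'a::real_normed_vector) \<Rightarrow> bool" where
  "unconditionally_summable a \<longleftrightarrow> (\<forall>\<pi>. bij \<pi> \<longrightarrow> summable (\<lambda>i. a (\<pi> i)))"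

definition unconditional_atomic_decomposition ::
    "('k::real_or_complex \<Rightarrow> 'a::banach \<Rightarrow> 'a) \<Rightarrow> (nat \<Rightarrow> 'a \<Rightarrow> 'k) \<Rightarrow> (nat \<Rightarrow> 'a) \<Rightarrow> bool" where
  "unconditional_atomic_decomposition smul f u \<longleftrightarrow>
     atomic_decomposition smul f u \<and>
     (\<forall>x. unconditionally_summable (\<lambda>i. smul (f i x) (u i)))"

definition boundedly_complete ::
    "('k::real_or_complex \<Rightarrow> 'a::banach \<Rightarrow> 'a) \<Rightarrow> (nat \<Rightarrow> 'a \<Rightarrow> 'k) \<Rightarrow> (nat \<Rightarrow> 'a) \<Rightarrow> bool" where
  "boundedly_complete smul f u \<longleftrightarrow>
     (\<forall>\<phi>\<in>bidual smul. summable (\<lambda>i. smul (\<phi> (f i)) (u i)))"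

definition c0 :: "(nat \<Rightarrow> 'k::real_or_complex) set" where
  "c0 = {a. a \<longlonglongrightarrow> 0}"

definition sup_norm :: "(nat \<Rightarrow> 'k::real_or_complex) \<Rightarrow> real" where
  "sup_norm a = (SUP i. norm (a i))"

text \<open>
  The two-sided estimate says that \<open>T\<close> is a linear homeomorphism of \<^const>\<open>c0\<close> onto its range.
\<close>

definition contains_copy_of_c0 :: "('k::real_or_complex \<Rightarrow> 'a::banach \<Rightarrow> 'a) \<Rightarrow> bool" where
  "contains_copy_of_c0 smul \<longleftrightarrow>
     (\<exists>T :: (nat \<Rightarrow> 'k) \<Rightarrow> 'a.
        (\<forall>a\<in>c0. \<forall>b\<in>c0. T (\<lambda>i. a i + b i) = T a + T b) \<and>
        (\<forall>c. \<forall>a\<in>c0. T (\<lambda>i. c * a i) = smul c (T a)) \<and>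
        (\<exists>A>0. \<exists>B>0. \<forall>a\<in>c0. A * sup_norm a \<le> norm (T a) \<and> norm (T a) \<le> B * sup_norm a))"

end

(*
Write S n x for the n-th partial sum of the expansion of x. Unconditionality and the uniform
boundedness principle give a constant K bounding all sums over finite index sets with bounded
multipliers. Both directions rest on a gliding hump: if sum y_j is weakly unconditionally
Cauchy, then S n y_j tends to 0 as j grows and to y_j as n grows, so along suitable
subsequences the block S (m (k+1)) - S (m k) almost fixes y (r k) and almost kills all
other y (r i).

If X contains c0 with basis y_k, then phi g = sum_k g (y (r k)) lies in the bidual, and the k-th
block of sum phi(f_i) u_i is close to y (r k). Hence this series is not Cauchy.

Conversely sum phi(f_i) u_i is weakly unconditionally Cauchy for every phi in the bidual. If it
diverges, it has blocks y_k bounded away from 0; the upper c0-estimate for them is clear, and the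
operators S (m (k+1)) - S (m k), being bounded by 2K, give the lower one along a subsequence. This
replaces the selection of a basic sequence in the Bessaga-Pelczynski theorem.
*)

theory Submission
  imports Defs
begin

section \<open>Facts about real normed spaces\<close>

text \<open>By Baire's theorem some closed set \<open>E n\<close> contains a ball of radius
  \<open>r\<close> around \<open>x0\<close>. Every vector of norm \<open>r\<close> is a difference
  of two points of that ball, so its images have norm at most \<open>2 * real n\<close>, and
  homogeneity does the rest.\<close>

lemma uniform_boundedness:
  fixes T :: "'i \<Rightarrow> 'a::banach \<Rightarrow> 'b::real_normed_vector"
  assumes lin: "\<And>i. i \<in> I \<Longrightarrow> bounded_linear (T i)"
    and pointwise: "\<And>x. \<exists>C. \<forall>i\<in>I. norm (T i x) \<le> C"
  shows "\<exists>C. \<forall>i\<in>I. \<forall>x. norm (T i x) \<le> C * norm x"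
proof -
  define E where "E n = {x. \<forall>i\<in>I. norm (T i x) \<le> real n}" for n :: nat
  have "closed (E n)" for n
  proof -
    have "E n = (\<Inter>i\<in>I. {x. norm (T i x) \<le> real n})"
      by (auto simp: E_def)
    moreover have "closed {x. norm (T i x) \<le> real n}" if "i \<in> I" for i
      by (intro closed_Collect_le continuous_intros
          linear_continuous_on lin that)
    ultimately show ?thesis by (simp add: closed_INT)
  qed
  moreover have "(\<Union>n. E n) = UNIV"
  proof (intro equalityI subset_UNIV subsetI)
    fix x
    obtain C where C: "\<forall>i\<in>I. norm (T i x) \<le> C" using pointwise by blast
    obtain n :: nat where "C \<le> real n" using real_arch_simple by blast
    then have "x \<in> E n" using C by (force simp: E_def)
    then show "x \<in> (\<Union>n. E n)" by blast
  qed
  ultimately obtain n where "interior (E n) \<noteq> {}"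
    using Baire_category_alt[of "euclidean :: 'a topology" "range E"]
      completely_metrizable_space_euclidean by auto
  then obtain x0 where "x0 \<in> interior (E n)" by blast
  then obtain r where r: "r > 0" "cball x0 r \<subseteq> E n"
    by (meson mem_interior_cball)
  have "norm (T i x) \<le> (2 * real n / r) * norm x" if i: "i \<in> I" for i x
  proof (cases "x = 0")
    case True
    then show ?thesis using linear_0[OF bounded_linear.linear[OF lin[OF i]]] by simp
  next
    case False
    interpret bounded_linear "T i" by (rule lin[OF i])
    define z where "z = (r / norm x) *\<^sub>R x"
    have "norm z = r" using False r by (simp add: z_def)
    then have "x0 + z \<in> cball x0 r" "x0 \<in> cball x0 r" using r by (auto simp: dist_norm)
    then have "x0 + z \<in> E n" "x0 \<in> E n" using r(2) by blast+
    then have "norm (T i (x0 + z)) \<le> n" "norm (T i x0) \<le> n"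
      using i by (auto simp: E_def)
    moreover have "norm (T i z) = norm (T i (x0 + z) - T i x0)" by (simp add: add)
    ultimately have "norm (T i z) \<le> 2 * real n"
      using norm_triangle_ineq4[of "T i (x0 + z)" "T i x0"] by linarith
    moreover have "norm (T i z) = r / norm x * norm (T i x)"
      using r by (simp add: z_def scaleR)
    ultimately show ?thesis using r False by (simp add: field_simps)
  qed
  then show ?thesis by blast
qed

text \<open>Such a permutation turns a sum over a scattered set \<open>G\<close> into a sum over
  consecutive indices, to which the Cauchy criterion of a rearranged series applies.\<close>

lemma bij_betw_image_prefix:
  fixes m n :: nat
  assumes G: "G \<subseteq> {m..<n}"
  shows "\<exists>p. bij_betw p {m..<n} {m..<n} \<and> bij_betw p {m..<m + card G} G"
proof -
  have fin: "finite G" using G finite_subset by blast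
  have le: "card G \<le> n - m" using card_mono[OF _ G] by simp
  obtain p where p: "bij_betw p {m..<m + card G} G"
    using finite_same_card_bij[of "{m..<m + card G}" G] fin by auto
  have "card {m + card G..<n} = card ({m..<n} - G)"
    using G fin le by (simp add: card_Diff_subset)
  then obtain q where q: "bij_betw q {m + card G..<n} ({m..<n} - G)"
    using finite_same_card_bij[of "{m + card G..<n}" "{m..<n} - G"] by auto
  let ?p = "\<lambda>x. if x \<in> {m..<m + card G} then p x else q x"
  have "bij_betw ?p ({m..<m + card G} \<union> {m + card G..<n}) (G \<union> ({m..<n} - G))"
    by (rule bij_betw_disjoint_Un[OF p q]) auto
  moreover have "{m..<m + card G} \<union> {m + card G..<n} = {m..<n}"
    using le G by (cases "G = {}") (auto simp: Suc_le_eq card_gt_0_iff fin)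
  moreover have "G \<union> ({m..<n} - G) = {m..<n}" using G by blast
  moreover have "bij_betw ?p {m..<m + card G} G"
    using p by (subst bij_betw_cong[where g = p]) auto
  ultimately show ?thesis by metis
qed

lemma strict_mono_interval_unique:
  fixes b :: "nat \<Rightarrow> nat"
  assumes "strict_mono b" "i \<in> {b k..<b (Suc k)}" "i \<in> {b l..<b (Suc l)}"
  shows "k = l"
proof (rule ccontr)
  assume "k \<noteq> l"
  then consider "Suc k \<le> l" | "Suc l \<le> k" by linarith
  then show False
    using assms(2,3) strict_mono_less_eq[OF assms(1), of "Suc k" l]
      strict_mono_less_eq[OF assms(1), of "Suc l" k]
    by cases auto
qed

text \<open>Unbounded finite sums leave, beyond every index, a finite set whose sum has norm at
  least 1. Placing such sets in consecutive blocks and moving each to the front of its block gives a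
  rearrangement that violates the Cauchy criterion.\<close>

lemma unconditionally_summable_bounded:
  fixes a :: "nat \<Rightarrow> 'a::banach"
  assumes "unconditionally_summable a"
  shows "\<exists>C. \<forall>F. finite F \<longrightarrow> norm (sum a F) \<le> C"
proof (rule ccontr)
  assume unb: "\<nexists>C. \<forall>F. finite F \<longrightarrow> norm (sum a F) \<le> C"
  have "\<exists>G n. m < n \<and> G \<subseteq> {m..<n} \<and> 1 \<le> norm (sum a G)" for m
  proof -
    \<comment> \<open>The excess over 1 pays for the indices below \<open>m\<close>, which are then
      removed from \<open>F\<close>.\<close>
    obtain F where F: "finite F" "norm (sum a F) > 1 + (\<Sum>i<m. norm (a i))"
      using unb by (meson not_le)
    have "sum a F = sum a (F - {..<m}) + sum a (F \<inter> {..<m})"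
      using F(1) by (metis add.commute sum.Int_Diff)
    moreover have "norm (sum a (F \<inter> {..<m})) \<le> (\<Sum>i<m. norm (a i))"
      by (rule order.trans[OF norm_sum sum_mono2]) auto
    ultimately have "1 \<le> norm (sum a (F - {..<m}))"
      using F(2) norm_triangle_ineq[of "sum a (F - {..<m})" "sum a (F \<inter> {..<m})"] by simp
    moreover obtain n where "F \<subseteq> {..<n}" using F(1) finite_nat_bounded by blast
    then have "F - {..<m} \<subseteq> {m..<max n (Suc m)}" by auto
    ultimately show ?thesis by (intro exI[of _ "F - {..<m}"] exI[of _ "max n (Suc m)"]) auto
  qed
  then obtain G n where n: "\<And>m. m < n m" and G: "\<And>m. G m \<subseteq> {m..<n m}"
      and norm_G: "\<And>m. 1 \<le> norm (sum a (G m))"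
    by metis
  define b where "b k = (n ^^ k) 0" for k
  have b_Suc: "b (Suc k) = n (b k)" and b_0: "b 0 = 0" for k by (simp_all add: b_def)
  have mono: "strict_mono b" by (simp add: strict_mono_Suc_iff b_Suc n)
  have "\<forall>k. \<exists>p. bij_betw p {b k..<b (Suc k)} {b k..<b (Suc k)} \<and>
      bij_betw p {b k..<b k + card (G (b k))} (G (b k))"
    unfolding b_Suc by (intro allI bij_betw_image_prefix G)
  from choice[OF this] obtain p where p: "\<And>k. bij_betw (p k) {b k..<b (Suc k)} {b k..<b (Suc k)}"
      and pG: "\<And>k. bij_betw (p k) {b k..<b k + card (G (b k))} (G (b k))"
    by blast
  note uniq = strict_mono_interval_unique[OF mono]
  \<comment> \<open>\<open>\<kappa> i\<close> is the block containing \<open>i\<close>. The blocks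
    partition the naturals, so the permutations \<open>p k\<close> glue to a bijection
    \<open>\<pi>\<close>.\<close>
  define \<kappa> where "\<kappa> i = (THE k. i \<in> {b k..<b (Suc k)})" for i
  define \<pi> where "\<pi> i = p (\<kappa> i) i" for i
  have \<kappa>: "\<kappa> i = k" if "i \<in> {b k..<b (Suc k)}" for i k
    unfolding \<kappa>_def using uniq that by blast
  have UN: "(\<Union>k. {b k..<b (Suc k)}) = UNIV"
  proof (intro equalityI subset_UNIV subsetI)
    fix i
    have "i < b (Suc i)" using strict_mono_imp_increasing[OF mono, of "Suc i"] by simp
    define l where "l = (LEAST l. i < b l)"
    have l: "i < b l" unfolding l_def by (rule LeastI) fact
    then obtain k where k: "l = Suc k" using b_0 by (cases l) auto
    then have "b k \<le> i" using not_less_Least[of k "\<lambda>l. i < b l"] by (simp add: l_def not_less)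
    then show "i \<in> (\<Union>k. {b k..<b (Suc k)})" using l k by auto
  qed
  have "bij_betw \<pi> (\<Union>k. {b k..<b (Suc k)}) (\<Union>k. {b k..<b (Suc k)})"
  proof (rule bij_betw_UNION_disjoint)
    show "disjoint_family_on (\<lambda>k. {b k..<b (Suc k)}) UNIV"
      unfolding disjoint_family_on_def using uniq by blast
    show "bij_betw \<pi> {b k..<b (Suc k)} {b k..<b (Suc k)}" for k
      using p[of k] by (subst bij_betw_cong[where g = "p k"]) (auto simp: \<pi>_def \<kappa>)
  qed
  then have "summable (\<lambda>i. a (\<pi> i))"
    using assms by (simp add: unconditionally_summable_def UN)
  then obtain N where N: "\<And>m n. m \<ge> N \<Longrightarrow> norm (\<Sum>i\<in>{m..<n}. a (\<pi> i)) < 1"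
    by (metis summable_Cauchy zero_less_one)
  \<comment> \<open>Since \<open>N \<le> b N\<close>, this prefix of block \<open>N\<close> lies
    where Cauchy sums are below 1, whereas \<open>\<pi>\<close> maps it onto
    \<open>G (b N)\<close>.\<close>
  let ?I = "{b N..<b N + card (G (b N))}"
  have "card (G (b N)) \<le> b (Suc N) - b N"
    using card_mono[OF _ G[of "b N"]] by (simp add: b_Suc)
  then have "(\<Sum>i\<in>?I. a (\<pi> i)) = (\<Sum>i\<in>?I. a (p N i))"
    by (intro sum.cong) (auto simp: \<pi>_def \<kappa>[of _ N])
  also have "\<dots> = sum a (G (b N))"
    by (rule sum.reindex_bij_betw[OF pG])
  finally show False
    using N[OF strict_mono_imp_increasing[OF mono], of "b N + card (G (b N))"] norm_G[of "b N"] by simp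
qed

text \<open>Rows and columns are chosen alternately: \<open>m (Suc k)\<close> so large that the
  columns up to \<open>r k\<close> have almost reached their limits, then \<open>r (Suc k)\<close>
  so large that the rows up to \<open>m (Suc k)\<close> almost vanish there. The error bound depends
  on \<open>i\<close> alone, so that for each block it can be summed over \<open>i\<close>.\<close>

lemma gliding_hump:
  fixes S :: "nat \<Rightarrow> nat \<Rightarrow> 'a::real_normed_vector"
  assumes row: "\<And>n. (\<lambda>j. S n j) \<longlonglongrightarrow> 0"
    and col: "\<And>j. (\<lambda>n. S n j) \<longlonglongrightarrow> y j"
    and "0 < \<eta>"
  obtains m r where "strict_mono m" "strict_mono r"
    "\<And>k i. norm (S (m (Suc k)) (r i) - S (m k) (r i) - (if i = k then y (r k) else 0)) \<le> \<eta> * (1/2)^i"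
proof -
  \<comment> \<open>Half of the allowance, since a difference of two rows costs two errors.\<close>
  define \<epsilon> where "\<epsilon> k = \<eta> / 2 * (1/2)^k" for k :: nat
  have \<epsilon>: "\<epsilon> k > 0" for k using assms by (simp add: \<epsilon>_def)
  have \<epsilon>_mono: "\<epsilon> k \<le> \<epsilon> i" if "i \<le> k" for i k
    using assms that by (simp add: \<epsilon>_def power_decreasing)
  have "\<forall>\<^sub>F j in sequentially. norm (S n j) \<le> \<epsilon> k" for n k
    using tendstoD[OF row[of n] \<epsilon>[of k]] by (rule eventually_mono) simp
  then have ev_row: "\<forall>\<^sub>F j in sequentially. \<forall>n\<in>{..N}. norm (S n j) \<le> \<epsilon> k" for N k
    by (intro eventually_ball_finite) auto
  have "\<forall>\<^sub>F n in sequentially. norm (S n j - y j) \<le> \<epsilon> k" for j k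
    using tendstoD[OF col[of j] \<epsilon>[of k]] by (rule eventually_mono) (simp add: dist_norm)
  then have ev_col: "\<forall>\<^sub>F n in sequentially. \<forall>j\<in>{..J}. norm (S n j - y j) \<le> \<epsilon> k" for J k
    by (intro eventually_ball_finite) auto
  \<comment> \<open>A state is a pair of a row and a column index. \<open>P\<close> is the smallness
    carried by the state itself, \<open>Q\<close> the relation to its successor.\<close>
  define P where "P k x \<longleftrightarrow> (\<forall>n\<le>fst x. norm (S n (snd x)) \<le> \<epsilon> k)" for k and x :: "nat \<times> nat"
  define Q where "Q k x x' \<longleftrightarrow> fst x < fst x' \<and> snd x < snd x' \<and>
      (\<forall>j\<le>snd x. \<forall>n\<ge>fst x'. norm (S n j - y j) \<le> \<epsilon> k)" for k and x x' :: "nat \<times> nat"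
  have "\<exists>x. \<forall>k. P k (x k) \<and> Q k (x k) (x (Suc k))"
  proof (rule dependent_nat_choice)
    obtain j where "\<forall>n\<in>{..0}. norm (S n j) \<le> \<epsilon> 0"
      using eventually_happens'[OF sequentially_bot ev_row[of 0 0]] by blast
    then have "P 0 (0, j)" by (auto simp: P_def)
    then show "\<exists>x. P 0 x" ..
  next
    fix x k assume "P k x"
    obtain M where M: "\<And>n. n \<ge> M \<Longrightarrow> \<forall>j\<in>{..snd x}. norm (S n j - y j) \<le> \<epsilon> k"
      using ev_col[of "snd x" k] unfolding eventually_sequentially by blast
    define m where "m = max M (Suc (fst x))"
    obtain j where j: "j > snd x" "\<forall>n\<in>{..m}. norm (S n j) \<le> \<epsilon> (Suc k)"
      using eventually_happens'[OF sequentially_bot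
          eventually_conj[OF eventually_gt_at_top[of "snd x"] ev_row[of m "Suc k"]]] by blast
    have "P (Suc k) (m, j) \<and> Q k x (m, j)"
      using j M by (auto simp: P_def Q_def m_def)
    then show "\<exists>x'. P (Suc k) x' \<and> Q k x x'" ..
  qed
  then obtain x where x: "\<And>k. P k (x k)" "\<And>k. Q k (x k) (x (Suc k))" by blast
  define m r where "m = fst \<circ> x" and "r = snd \<circ> x"
  have m: "strict_mono m" and r: "strict_mono r"
    using x(2) by (auto simp: m_def r_def Q_def strict_mono_Suc_iff)
  have small: "norm (S (m k) (r i)) \<le> \<epsilon> i" if "k \<le> i" for k i
    using x(1)[of i] strict_mono_less_eq[OF m] that by (auto simp: P_def m_def r_def)
  have close: "norm (S (m k) (r i) - y (r i)) \<le> \<epsilon> i" if "i < k" for k i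
    using x(2)[of i] strict_mono_less_eq[OF m, of "Suc i" k] that by (auto simp: Q_def m_def r_def)
  \<comment> \<open>For \<open>i < k\<close> both rows are close to \<open>y (r i)\<close> and
    cancel; for \<open>i = k\<close> only the later row has come close to \<open>y (r k)\<close>;
    for \<open>i > k\<close> both are small.\<close>
  have "norm (S (m (Suc k)) (r i) - S (m k) (r i) - (if i = k then y (r k) else 0)) \<le> \<epsilon> i + \<epsilon> i" for k i
  proof -
    consider "i < k" | "i = k" | "k < i" by linarith
    then show ?thesis
    proof cases
      case 1
      have "S (m (Suc k)) (r i) - S (m k) (r i) = (S (m (Suc k)) (r i) - y (r i)) - (S (m k) (r i) - y (r i))"
        by simp
      then show ?thesis
        using 1 norm_triangle_ineq4[of "S (m (Suc k)) (r i) - y (r i)" "S (m k) (r i) - y (r i)"]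
          close[of i k] close[of i "Suc k"] by auto
    next
      case 2
      have "S (m (Suc k)) (r i) - S (m k) (r i) - (if i = k then y (r k) else 0)
          = (S (m (Suc k)) (r i) - y (r i)) - S (m k) (r i)"
        using 2 by simp
      also have "norm \<dots> \<le> \<epsilon> i + \<epsilon> i"
        using 2 norm_triangle_ineq4[of "S (m (Suc k)) (r i) - y (r i)" "S (m k) (r i)"]
          close[of i "Suc k"] small[of k i] by auto
      finally show ?thesis .
    next
      case 3
      then show ?thesis
        using norm_triangle_ineq4[of "S (m (Suc k)) (r i)" "S (m k) (r i)"]
          small[of k i] small[of "Suc k" i] by auto
    qed
  qed
  moreover have "\<epsilon> i + \<epsilon> i = \<eta> * (1/2)^i" for i by (simp add: \<epsilon>_def)
  ultimately show ?thesis using that[OF m r] by simp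
qed

text \<open>A combination with coefficients in \<open>[0,1]\<close> is a convex combination of
  subset sums. Each induction step averages the sums with and without \<open>v x\<close>; the offset
  \<open>w\<close> records what has already been included.\<close>

lemma norm_sum_convex_le:
  fixes v :: "'i \<Rightarrow> 'a::real_normed_vector"
  assumes "finite F" "\<And>G. G \<subseteq> F \<Longrightarrow> norm (w + sum v G) \<le> M"
    "\<And>i. i \<in> F \<Longrightarrow> 0 \<le> t i \<and> t i \<le> 1"
  shows "norm (w + (\<Sum>i\<in>F. t i *\<^sub>R v i)) \<le> M"
  using assms
proof (induction F arbitrary: w rule: finite_induct)
  case empty
  then show ?case using empty(1)[of "{}"] by simp
next
  case (insert x F)
  let ?s = "\<Sum>i\<in>F. t i *\<^sub>R v i"
  have 1: "norm (w + ?s) \<le> M"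
    using insert.prems by (intro insert.IH) (auto simp: subset_insertI2)
  have 2: "norm (w + v x + ?s) \<le> M"
  proof (intro insert.IH)
    fix G assume "G \<subseteq> F"
    then have "norm (w + sum v (insert x G)) \<le> M" by (intro insert.prems) auto
    moreover have "sum v (insert x G) = v x + sum v G"
      using \<open>G \<subseteq> F\<close> insert.hyps by (intro sum.insert) (auto dest: finite_subset)
    ultimately show "norm (w + v x + sum v G) \<le> M" by (simp add: add.assoc)
  qed (use insert.prems in auto)
  have t: "0 \<le> t x" "t x \<le> 1" using insert.prems by auto
  have "w + (\<Sum>i\<in>insert x F. t i *\<^sub>R v i) = t x *\<^sub>R (w + v x + ?s) + (1 - t x) *\<^sub>R (w + ?s)"
    using insert.hyps by (simp add: algebra_simps)
  also have "norm \<dots> \<le> t x * M + (1 - t x) * M"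
    using 1 2 t by (intro norm_triangle_le add_mono) (auto intro: mult_left_mono)
  finally show ?case by (simp add: algebra_simps)
qed

text \<open>Positive and negative parts of \<open>t\<close> have values in \<open>[0,1]\<close>;
  treating them separately costs the factor 2.\<close>

lemma norm_sum_scaleR_le:
  fixes v :: "'i \<Rightarrow> 'a::real_normed_vector"
  assumes "finite F" "\<And>G. G \<subseteq> F \<Longrightarrow> norm (sum v G) \<le> M" "\<And>i. i \<in> F \<Longrightarrow> \<bar>t i\<bar> \<le> 1"
  shows "norm (\<Sum>i\<in>F. t i *\<^sub>R v i) \<le> 2 * M"
proof -
  have "norm (\<Sum>i\<in>F. max 0 (t i) *\<^sub>R v i) \<le> M" "norm (\<Sum>i\<in>F. max 0 (- t i) *\<^sub>R v i) \<le> M"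
    using norm_sum_convex_le[of F 0 v M "\<lambda>i. max 0 (t i)"]
      norm_sum_convex_le[of F 0 v M "\<lambda>i. max 0 (- t i)"] assms by (auto simp: abs_le_iff)
  moreover have "(\<Sum>i\<in>F. t i *\<^sub>R v i) = (\<Sum>i\<in>F. max 0 (t i) *\<^sub>R v i) - (\<Sum>i\<in>F. max 0 (- t i) *\<^sub>R v i)"
    by (auto simp: sum_subtractf[symmetric] scaleR_left_diff_distrib[symmetric] max_def intro!: sum.cong)
  ultimately show ?thesis
    using norm_triangle_ineq4[of "\<Sum>i\<in>F. max 0 (t i) *\<^sub>R v i" "\<Sum>i\<in>F. max 0 (- t i) *\<^sub>R v i"] by simp
qed

text \<open>The classical dominated extension by one vector, iterated over \<open>B\<close>. The
  one-sided bound suffices, since the span is closed under negation.\<close>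

lemma finite_dim_Hahn_Banach:
  fixes y :: "'a::real_normed_vector"
  assumes "finite B"
  shows "\<exists>g :: 'a \<Rightarrow> real. linear g \<and> g y = norm y \<and> (\<forall>x\<in>span (insert y B). g x \<le> norm x)"
  using assms
proof (induction B rule: finite_induct)
  case empty
  show ?case
  proof (cases "y = 0")
    case True
    then show ?thesis by (intro exI[of _ "\<lambda>x. 0"]) (auto simp: span_singleton linear_zero)
  next
    case False
    then obtain g :: "'a \<Rightarrow> real" where g: "linear g" "\<forall>x\<in>{y}. g x = norm y"
      using linear_independent_extend[of "{y}" "\<lambda>x. norm y"] by auto
    then show ?thesis
      by (intro exI[of _ g]) (auto simp: span_singleton linear_scale abs_ge_self mult_right_mono)
  qed
next
  case (insert v B)
  define V where "V = span (insert y B)"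
  obtain g :: "'a \<Rightarrow> real" where g: "linear g" "g y = norm y" "\<And>x. x \<in> V \<Longrightarrow> g x \<le> norm x"
    using insert.IH unfolding V_def by blast
  have V: "subspace V" and y: "y \<in> V" by (auto simp: V_def span_base)
  have span: "span (insert y (insert v B)) = span (insert v (insert y B))"
    by (simp add: insert_commute)
  show ?case
  proof (cases "v \<in> V")
    case True
    then have "span (insert y (insert v B)) = V" unfolding span V_def by (rule span_redundant)
    then show ?thesis using g by auto
  next
    case False
    obtain C where C: "C \<subseteq> V" "independent C" "V \<subseteq> span C" by (rule basis_exists[of V])
    have VC: "span C = V" using C V by (metis span_subspace)
    then have "independent (insert v C)" using False independent_insertI[OF _ C(2)] by blast
    \<comment> \<open>\<open>\<psi>\<close> vanishes on \<open>V\<close> and is 1 at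
      \<open>v\<close>: adding a multiple of it moves the value at \<open>v\<close> and leaves
      \<open>g\<close> unchanged on \<open>V\<close>.\<close>
    from linear_independent_extend[OF this, of "\<lambda>x. if x = v then 1 else 0"]
    obtain \<psi> :: "'a \<Rightarrow> real"
      where \<psi>: "linear \<psi>" "\<And>x. x \<in> insert v C \<Longrightarrow> \<psi> x = (if x = v then 1 else 0)"
      by blast
    have \<psi>v: "\<psi> v = 1" using \<psi>(2)[of v] by simp
    have \<psi>V: "\<psi> x = 0" if "x \<in> V" for x
    proof -
      have "\<psi> x = 0" if "x \<in> C" for x using \<psi>(2)[of x] that False C(1) by auto
      then show ?thesis using that linear_eq_0_on_span[OF \<psi>(1), of C x] VC by blast
    qed
    \<comment> \<open>The new value at \<open>v\<close> must lie above every
      \<open>g x - norm (x - v)\<close> and below every \<open>norm (x' + v) - g x'\<close>; the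
      supremum of the former is one such value.\<close>
    define s where "s = Sup ((\<lambda>x. g x - norm (x - v)) ` V)"
    have ineq: "g x - norm (x - v) \<le> norm (x' + v) - g x'" if "x \<in> V" "x' \<in> V" for x x'
    proof -
      have "g x + g x' = g (x + x')" using g(1) by (simp add: linear_add)
      also have "\<dots> \<le> norm (x + x')" using g(3) V that by (simp add: subspace_add)
      also have "x + x' = (x - v) + (x' + v)" by simp
      also have "norm \<dots> \<le> norm (x - v) + norm (x' + v)" by (rule norm_triangle_ineq)
      finally show ?thesis by simp
    qed
    have bdd: "bdd_above ((\<lambda>x. g x - norm (x - v)) ` V)"
      using ineq[of _ y] y by (auto intro!: bdd_aboveI)
    have s1: "g x - s \<le> norm (x - v)" if "x \<in> V" for x
      using cSUP_upper[OF that bdd] by (simp add: s_def)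
    have s2: "g x + s \<le> norm (x + v)" if "x \<in> V" for x
    proof -
      have "s \<le> norm (x + v) - g x"
        unfolding s_def using y ineq that by (intro cSUP_least) auto
      then show ?thesis by simp
    qed
    define g' where "g' x = g x + (s - g v) * \<psi> x" for x
    have lin: "linear g'"
      by (rule linearI) (simp_all add: g'_def linear_add[OF g(1)] linear_add[OF \<psi>(1)]
          linear_scale[OF g(1)] linear_scale[OF \<psi>(1)] algebra_simps)
    have g'V: "g' x = g x" if "x \<in> V" for x using \<psi>V[OF that] by (simp add: g'_def)
    have g'v: "g' v = s" by (simp add: g'_def \<psi>v)
    have "g' x \<le> norm x" if x: "x \<in> span (insert y (insert v B))" for x
    proof -
      obtain k where k: "x - k *\<^sub>R v \<in> V"
        using x unfolding span span_breakdown_eq[of x v "insert y B"] V_def by blast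
      define w where "w = x - k *\<^sub>R v"
      have w: "w \<in> V" "x = w + k *\<^sub>R v" using k by (auto simp: w_def)
      have gx: "g' x = g w + k * s"
        using lin by (simp add: w(2) linear_add linear_scale g'V[OF w(1)] g'v)
      \<comment> \<open>Dividing by the absolute value of \<open>k\<close> leaves a vector of
        \<open>V\<close> plus or minus \<open>v\<close>: \<open>s2\<close> settles the positive
        sign, \<open>s1\<close> the negative one.\<close>
      consider "k = 0" | "k > 0" | "k < 0" by linarith
      then show ?thesis
      proof cases
        case 1
        then show ?thesis using gx w g(3) by simp
      next
        case 2
        have "(1 / k) *\<^sub>R w \<in> V" using V w by (simp add: subspace_scale)
        from s2[OF this] have "k * (g w / k + s) \<le> k * norm ((1 / k) *\<^sub>R w + v)"
          using 2 g(1) by (intro mult_left_mono) (auto simp: linear_scale)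
        moreover have "k * norm ((1 / k) *\<^sub>R w + v) = norm (k *\<^sub>R ((1 / k) *\<^sub>R w + v))" using 2 by simp
        moreover have "k *\<^sub>R ((1 / k) *\<^sub>R w + v) = x" using 2 w by (simp add: algebra_simps)
        moreover have "k * (g w / k + s) = g w + k * s" using 2 by (simp add: distrib_left)
        ultimately show ?thesis using gx by simp
      next
        case 3
        have "(- 1 / k) *\<^sub>R w \<in> V" by (rule subspace_scale[OF V w(1)])
        from s1[OF this] have "- k * (- g w / k - s) \<le> - k * norm ((- 1 / k) *\<^sub>R w - v)"
          using 3 g(1) by (intro mult_left_mono) (auto simp: linear_scale linear_neg)
        moreover have "- k * norm ((- 1 / k) *\<^sub>R w - v) = norm ((- k) *\<^sub>R ((- 1 / k) *\<^sub>R w - v))"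
          using 3 by simp
        moreover have "(- k) *\<^sub>R ((- 1 / k) *\<^sub>R w - v) = x" using 3 w by (simp add: algebra_simps)
        ultimately have "- k * (- g w / k - s) \<le> norm x" by metis
        moreover have "- k * (- g w / k - s) = g w + k * s" using 3 by (simp add: right_diff_distrib)
        ultimately show ?thesis using gx by simp
      qed
    qed
    then show ?thesis using lin g(2) g'V[OF y] by metis
  qed
qed

section \<open>Scalars and null sequences\<close>

text \<open>An intrinsic form of the class axiom: either all scalars are real, or \<open>j\<close>
  is an imaginary unit and both real coordinates are controlled by the norm. Later proofs can split
  scalars without transporting them along the embedding \<open>h\<close>.\<close>

lemma real_or_complex_cases:
  obtains (real) "\<And>c :: 'k::real_or_complex. \<exists>a. c = of_real a"
  | (complex) j :: "'k::real_or_complex" where "j * j = -1" "norm j = 1"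
      "\<And>a b. \<bar>a\<bar> \<le> norm (of_real a + of_real b * j)" "\<And>a b. \<bar>b\<bar> \<le> norm (of_real a + of_real b * j)"
      "\<And>c. \<exists>a b. c = of_real a + of_real b * j"
proof -
  from ex_iso_real_or_complex[where 'a = 'k]
  obtain h :: "'k \<Rightarrow> complex" where h: "(\<forall>a b. h (a + b) = h a + h b) \<and>
      (\<forall>a b. h (a * b) = h a * h b) \<and> h 1 = 1 \<and> (\<forall>a. norm (h a) = norm a) \<and>
      (range h = \<real> \<or> range h = UNIV)"
    by (rule exE)
  note add = h[THEN conjunct1, rule_format]
    and mult = h[THEN conjunct2, THEN conjunct1, rule_format]
    and one = h[THEN conjunct2, THEN conjunct2, THEN conjunct1]
    and norm = h[THEN conjunct2, THEN conjunct2, THEN conjunct2, THEN conjunct1, rule_format]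
    and range = h[THEN conjunct2, THEN conjunct2, THEN conjunct2, THEN conjunct2]
  have diff: "h (a - b) = h a - h b" for a b
    using add[of "a - b" b] by (simp add: eq_diff_eq)
  have inj: "a = b" if "h a = h b" for a b
    using norm[of "a - b"] that by (simp add: diff)
  \<comment> \<open>Only ring operations and norms are known to be preserved. The distances of
    \<open>z\<close> to 0 and 1 determine its real part, and then its imaginary part
    vanishes.\<close>
  have of_real: "h (of_real r) = of_real r" for r
  proof -
    define z where "z = h (of_real r)"
    have "norm z = \<bar>r\<bar>" by (simp add: z_def norm)
    moreover have "z - 1 = h (of_real (r - 1))" by (simp add: z_def diff one)
    then have "norm (z - 1) = \<bar>r - 1\<bar>" by (simp only: norm norm_of_real)
    ultimately have "(norm z)\<^sup>2 = r\<^sup>2" "(norm (z - 1))\<^sup>2 = (r - 1)\<^sup>2" by simp_all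
    then have *: "(Re z)\<^sup>2 + (Im z)\<^sup>2 = r\<^sup>2" "(Re z - 1)\<^sup>2 + (Im z)\<^sup>2 = (r - 1)\<^sup>2"
      by (simp_all add: cmod_power2)
    then have "Re z = r" by (simp add: power2_eq_square algebra_simps)
    with * have "z = of_real r" by (simp add: complex_eq_iff)
    then show ?thesis by (simp add: z_def)
  qed
  from range show ?thesis
  proof
    assume R: "range h = \<real>"
    show ?thesis
    proof (rule real)
      fix c
      have "h c \<in> \<real>" using R by auto
      then obtain a where "h c = of_real a" by (auto elim: Reals_cases)
      then show "\<exists>a. c = of_real a" using inj of_real by metis
    qed
  next
    assume U: "range h = UNIV"
    then obtain j where j: "h j = \<i>" by (metis rangeE UNIV_I)
    have h: "h (of_real a + of_real b * j) = Complex a b" for a b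
      by (simp add: add mult of_real j complex_eq_iff)
    have n: "norm (of_real a + of_real b * j) = norm (Complex a b)" for a b
      using norm h by metis
    have "h (-1) = -1" using diff[of 0 1] diff[of 0 0] one by simp
    then have "h (j * j) = h (-1)" by (simp add: mult j)
    then have "j * j = -1" by (rule inj)
    moreover have "norm j = 1" using norm[of j] j by simp
    moreover have "\<exists>a b. c = of_real a + of_real b * j" for c
      by (intro exI[of _ "Re (h c)"] exI[of _ "Im (h c)"] inj) (simp add: h)
    moreover have "\<bar>a\<bar> \<le> norm (of_real a + of_real b * j)" "\<bar>b\<bar> \<le> norm (of_real a + of_real b * j)" for a b
      using abs_Re_le_cmod[of "Complex a b"] abs_Im_le_cmod[of "Complex a b"] by (simp_all add: n)
    ultimately show ?thesis using complex by blast
  qed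
qed

text \<open>Completeness is not part of the scalar class, so the claim is reduced to the real
  coordinates, which are dominated by the norm.\<close>

lemma summable_of_summable_norm:
  fixes c :: "nat \<Rightarrow> 'k::real_or_complex"
  assumes "summable (\<lambda>i. norm (c i))"
  shows "summable c"
proof (cases rule: real_or_complex_cases[where 'k = 'k])
  case real
  then have "\<forall>i. \<exists>a. c i = of_real a" by blast
  then obtain a where a: "\<And>i. c i = of_real (a i)" by metis
  have "summable a" using assms by (simp add: a summable_rabs_cancel)
  then show ?thesis unfolding a[abs_def] by (rule summable_of_real)
next
  case (complex j)
  then have "\<forall>i. \<exists>a b. c i = of_real a + of_real b * j" by blast
  then obtain a b where c: "\<And>i. c i = of_real (a i) + of_real (b i) * j" by metis
  have le: "norm (a i) \<le> norm (c i)" "norm (b i) \<le> norm (c i)" for i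
    unfolding c real_norm_def by (rule complex)+
  have a: "summable a" by (rule summable_comparison_test'[OF assms le(1)])
  have b: "summable b" by (rule summable_comparison_test'[OF assms le(2)])
  have "c = (\<lambda>i. of_real (a i) + of_real (b i) * j)" by (rule ext) (rule c)
  moreover have "summable (\<lambda>i. of_real (a i) + of_real (b i) * j)"
    by (rule summable_add[OF summable_of_real[OF a] summable_mult2[OF summable_of_real[OF b]]])
  ultimately show ?thesis by (simp only:)
qed

text \<open>This adds up the errors of a gliding hump; 2 is the value of the geometric
  series.\<close>

lemma sums_norm_le:
  fixes d :: "nat \<Rightarrow> 'a::banach"
  assumes "d sums s" "\<And>i. norm (d i) \<le> e * (1/2)^i"
  shows "norm s \<le> 2 * e"
proof -
  have g: "(\<lambda>i. e * (1/2)^i) sums (e * 2)"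
    using sums_mult[OF geometric_sums[of "1/2 :: real"], of e] by simp
  have "norm (suminf d) \<le> (\<Sum>i. e * (1/2)^i)"
    using assms(2) sums_summable[OF g] by (rule norm_suminf_le)
  then show ?thesis using assms(1) g by (simp add: sums_unique[symmetric] mult.commute)
qed

lemma finite_support_in_c0:
  "finite F \<Longrightarrow> (\<lambda>i. if i \<in> F then a i else 0) \<in> c0"
  unfolding c0_def mem_Collect_eq
proof (rule tendsto_eventually)
  assume "finite F"
  then obtain N where "F \<subseteq> {..<N}" using finite_nat_bounded by blast
  then show "\<forall>\<^sub>F i in sequentially. (if i \<in> F then a i else 0) = 0"
    by (intro eventually_sequentiallyI[of N]) auto
qed

lemma norm_le_sup_norm:
  assumes "a \<in> c0"
  shows "norm (a i) \<le> sup_norm a"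
proof -
  have "Bseq a" using assms convergent_imp_Bseq by (auto simp: c0_def convergent_def)
  then have "bdd_above (range (\<lambda>i. norm (a i)))"
    unfolding Bseq_def by (auto intro: bdd_aboveI2)
  then show ?thesis unfolding sup_norm_def by (intro cSUP_upper) auto
qed

lemma sup_norm_le: "(\<And>i. norm (a i) \<le> e) \<Longrightarrow> sup_norm a \<le> e"
  unfolding sup_norm_def by (rule cSUP_least) auto

section \<open>Weakly unconditionally Cauchy series\<close>

context banach_space_over
begin

section \<open>Scalar multipliers in finite sums and norming functionals\<close>

lemma bounded_linear_smul: "bounded_linear (smul c)"
proof (rule bounded_linear_intro[of _ "norm c"])
  show "smul c (r *\<^sub>R x) = r *\<^sub>R smul c x" for r x
    unfolding smul_of_real[symmetric] scale_scale by (simp add: mult.commute)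
qed (simp_all add: scale_right_distrib norm_smul mult.commute)

lemma bounded_linear_smul_left: "bounded_linear (\<lambda>c. smul c x)"
proof (rule bounded_linear_intro[of _ "norm x"])
  show "smul (r *\<^sub>R c) x = r *\<^sub>R smul c x" for r c
    unfolding smul_of_real[symmetric] scale_scale by (simp add: scaleR_conv_of_real)
qed (simp_all add: scale_left_distrib norm_smul)

text \<open>Real and imaginary parts of the coefficients each contribute
  \<open>2 * M\<close>.\<close>

lemma norm_sum_smul_le:
  assumes "finite F" "\<And>G. G \<subseteq> F \<Longrightarrow> norm (sum v G) \<le> M" "\<And>i. i \<in> F \<Longrightarrow> norm (a i) \<le> 1"
  shows "norm (\<Sum>i\<in>F. smul (a i) (v i)) \<le> 4 * M"
proof -
  have "0 \<le> M" using assms(2)[of "{}"] by simp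
  show ?thesis
  proof (cases rule: real_or_complex_cases[where 'k = 'k])
    case real
    then have "\<forall>i. \<exists>t. a i = of_real t" by blast
    then obtain t where t: "\<And>i. a i = of_real (t i)" by metis
    have "norm (\<Sum>i\<in>F. t i *\<^sub>R v i) \<le> 2 * M"
      using assms by (intro norm_sum_scaleR_le) (auto simp: t)
    then show ?thesis using \<open>0 \<le> M\<close> by (simp add: t smul_of_real)
  next
    case (complex j)
    then have "\<forall>i. \<exists>s t. a i = of_real s + of_real t * j" by blast
    then obtain s t where a: "\<And>i. a i = of_real (s i) + of_real (t i) * j" by metis
    have st: "\<bar>s i\<bar> \<le> 1" "\<bar>t i\<bar> \<le> 1" if "i \<in> F" for i
      using complex(3,4)[of "s i" "t i"] complex(4)[of "t i" "s i"] assms(3)[OF that] by (auto simp: a)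
    have "norm (\<Sum>i\<in>F. s i *\<^sub>R v i) \<le> 2 * M" "norm (\<Sum>i\<in>F. t i *\<^sub>R v i) \<le> 2 * M"
      using assms st by (intro norm_sum_scaleR_le; simp)+
    moreover have "(\<Sum>i\<in>F. smul (a i) (v i)) = (\<Sum>i\<in>F. s i *\<^sub>R v i) + smul j (\<Sum>i\<in>F. t i *\<^sub>R v i)"
    proof -
      have "smul (of_real (t i) * j) (v i) = smul j (t i *\<^sub>R v i)" for i
        unfolding smul_of_real[symmetric] scale_scale by (simp add: mult.commute)
      then show ?thesis
        by (simp add: a scale_left_distrib sum.distrib scale_sum_right smul_of_real)
    qed
    moreover have "norm (smul j (\<Sum>i\<in>F. t i *\<^sub>R v i)) = norm (\<Sum>i\<in>F. t i *\<^sub>R v i)"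
      by (simp add: norm_smul complex)
    moreover have "norm (\<Sum>i\<in>F. smul (a i) (v i))
        \<le> norm (\<Sum>i\<in>F. s i *\<^sub>R v i) + norm (smul j (\<Sum>i\<in>F. t i *\<^sub>R v i))"
      unfolding calculation(3) by (rule norm_triangle_ineq)
    ultimately show ?thesis by linarith
  qed
qed

text \<open>
  Linearity of \<open>G\<close> holds everywhere, but boundedness only on the span of the \<open>u i\<close>. Thus the
  Hahn-Banach theorem is needed for finitely generated subspaces only. The factor \<open>2\<close> comes from
  passing from a real functional \<open>g\<close> to the complex one \<open>g x - \<i> g (\<i> x)\<close>.
\<close>

lemma norming_functional:
  assumes F: "finite F"
  obtains G :: "'a \<Rightarrow> 'k" where "\<And>x y. G (x + y) = G x + G y" "\<And>c x. G (smul c x) = c * G x"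
    "norm (\<Sum>i\<in>F. smul (c i) (u i)) \<le> norm (G (\<Sum>i\<in>F. smul (c i) (u i)))"
    "\<And>d. norm (G (\<Sum>i\<in>F. smul (d i) (u i))) \<le> 2 * norm (\<Sum>i\<in>F. smul (d i) (u i))"
proof (cases rule: real_or_complex_cases[where 'k = 'k])
  case real
  define y where "y = (\<Sum>i\<in>F. smul (c i) (u i))"
  obtain g :: "'a \<Rightarrow> real" where g: "Real_Vector_Spaces.linear g" "g y = norm y"
      "\<And>x. x \<in> real_vector.span (insert y (u ` F)) \<Longrightarrow> g x \<le> norm x"
    using finite_dim_Hahn_Banach[of "u ` F" y] F by auto
  show ?thesis
  proof (rule that[of "\<lambda>x. of_real (g x)"])
    show "of_real (g (x + y)) = (of_real (g x) + of_real (g y) :: 'k)" for x y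
      by (simp add: real_vector.linear_add[OF g(1)])
    show "of_real (g (smul c x)) = c * of_real (g x)" for c x
    proof -
      obtain a where "c = of_real a" using real by blast
      then show ?thesis by (simp add: smul_of_real real_vector.linear_scale[OF g(1)])
    qed
    show "norm (\<Sum>i\<in>F. smul (c i) (u i)) \<le> norm (of_real (g (\<Sum>i\<in>F. smul (c i) (u i))) :: 'k)"
      using g(2) by (simp add: y_def)
    fix d
    let ?x = "\<Sum>i\<in>F. smul (d i) (u i)"
    have x: "?x \<in> real_vector.span (insert y (u ` F))"
    proof (intro real_vector.span_sum)
      fix i assume "i \<in> F"
      moreover obtain a where "d i = of_real a" using real by blast
      ultimately show "smul (d i) (u i) \<in> real_vector.span (insert y (u ` F))"
        by (simp add: smul_of_real real_vector.span_scale real_vector.span_base)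
    qed
    then have "g (- ?x) \<le> norm (- ?x)" "g ?x \<le> norm ?x" 
      by (intro g(3) real_vector.span_neg; assumption)+
    then have "\<bar>g ?x\<bar> \<le> norm ?x" by (simp add: real_vector.linear_neg[OF g(1)])
    then show "norm (of_real (g ?x) :: 'k) \<le> 2 * norm ?x" by simp
  qed
next
  case (complex j)
  define y where "y = (\<Sum>i\<in>F. smul (c i) (u i))"
  \<comment> \<open>The multiples by \<open>j\<close> are included so that the real span contains
    all combinations of the \<open>u i\<close> with scalars from \<open>'k\<close>.\<close>
  define B where "B = u ` F \<union> (\<lambda>i. smul j (u i)) ` F"
  obtain g :: "'a \<Rightarrow> real" where g: "Real_Vector_Spaces.linear g" "g y = norm y"
      "\<And>x. x \<in> real_vector.span (insert y B) \<Longrightarrow> g x \<le> norm x"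
    using finite_dim_Hahn_Banach[of B y] F by (auto simp: B_def)
  define G where "G x = of_real (g x) - of_real (g (smul j x)) * j" for x
  have g_scale: "g (smul (of_real a) x) = a * g x" for a x
    using real_vector.linear_scale[OF g(1)] by (simp add: smul_of_real)
  have g_add: "g (x + y) = g x + g y" for x y
    by (rule real_vector.linear_add[OF g(1)])
  have jj: "smul j (smul j x) = - x" for x by (simp add: complex)
  have comb: "(\<Sum>i\<in>F. smul (d i) (u i)) \<in> real_vector.span (insert y B)" for d
  proof (intro real_vector.span_sum)
    fix i assume "i \<in> F"
    moreover obtain a b where "d i = of_real a + of_real b * j" using complex by blast
    then have "smul (d i) (u i) = a *\<^sub>R u i + b *\<^sub>R smul j (u i)"
      by (simp add: scale_left_distrib flip: scale_scale smul_of_real)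
    moreover have "u i \<in> real_vector.span (insert y B)" "smul j (u i) \<in> real_vector.span (insert y B)"
      using \<open>i \<in> F\<close> by (auto simp: B_def intro: real_vector.span_base)
    ultimately show "smul (d i) (u i) \<in> real_vector.span (insert y B)"
      by (simp add: real_vector.span_add real_vector.span_scale)
  qed
  have abs_g: "\<bar>g (\<Sum>i\<in>F. smul (d i) (u i))\<bar> \<le> norm (\<Sum>i\<in>F. smul (d i) (u i))" for d
    using g(3)[OF comb[of d]] g(3)[OF real_vector.span_neg[OF comb[of d]]]
    by (simp add: real_vector.linear_neg[OF g(1)])
  show ?thesis
  proof (rule that[of G])
    show G_add: "G (x + y) = G x + G y" for x y
      by (simp add: G_def g_add scale_right_distrib algebra_simps)
    show "G (smul c x) = c * G x" for c x
    proof -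
      obtain a b where c: "c = of_real a + of_real b * j" using complex by blast
      have 1: "G (smul (of_real a) x) = of_real a * G x" for a x
      proof -
        have "g (smul j (smul (of_real a) x)) = a * g (smul j x)"
          by (subst scale_left_commute) (rule g_scale)
        then show ?thesis unfolding G_def g_scale by (simp add: algebra_simps)
      qed
      have 2: "G (smul j x) = j * G x"
      proof -
        have "j * G x = of_real (g x) * j - of_real (g (smul j x)) * (j * j)"
          by (simp add: G_def algebra_simps)
        then show ?thesis
          by (simp add: G_def jj complex(1) real_vector.linear_neg[OF g(1)])
      qed
      have "G (smul c x) = G (smul (of_real a) x + smul (of_real b) (smul j x))"
        by (simp add: c scale_left_distrib)
      also have "\<dots> = of_real a * G x + of_real b * (j * G x)" by (simp only: G_add 1 2)
      also have "\<dots> = c * G x" by (simp add: c algebra_simps)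
      finally show ?thesis .
    qed
    show "norm (\<Sum>i\<in>F. smul (c i) (u i)) \<le> norm (G (\<Sum>i\<in>F. smul (c i) (u i)))"
      using complex(3)[of "g y" "- g (smul j y)"] g(2) by (simp add: G_def y_def)
    fix d
    let ?x = "\<Sum>i\<in>F. smul (d i) (u i)"
    have "smul j ?x = (\<Sum>i\<in>F. smul (j * d i) (u i))" by (simp add: scale_sum_right)
    then have "\<bar>g (smul j ?x)\<bar> \<le> norm (smul j ?x)" using abs_g[of "\<lambda>i. j * d i"] by simp
    then have "\<bar>g (smul j ?x)\<bar> \<le> norm ?x" by (simp add: norm_smul complex)
    then show "norm (G ?x) \<le> 2 * norm ?x"
      unfolding G_def using abs_g[of d] complex(2)
      by (intro norm_triangle_le_diff) (simp add: norm_mult)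
  qed
qed

section \<open>Finite combinations in the dual and bidual\<close>

lemma dual_sum:
  assumes "finite F" "\<And>i. i \<in> F \<Longrightarrow> f i \<in> dual smul"
  shows "(\<lambda>x. \<Sum>i\<in>F. c i * f i x) \<in> dual smul"
proof -
  have "bounded_linear (\<lambda>x. \<Sum>i\<in>F. c i * f i x)"
    using assms by (intro bounded_linear_sum bounded_linear_const_mult) (auto simp: dual_def)
  then show ?thesis
    using assms by (auto simp: dual_def sum_distrib_left mult.left_commute intro!: sum.cong)
qed

lemma bidual_add:
  "\<phi> \<in> bidual smul \<Longrightarrow> f \<in> dual smul \<Longrightarrow> g \<in> dual smul \<Longrightarrow> \<phi> (\<lambda>x. f x + g x) = \<phi> f + \<phi> g"
  by (simp add: bidual_def)

lemma bidual_scale: "\<phi> \<in> bidual smul \<Longrightarrow> f \<in> dual smul \<Longrightarrow> \<phi> (\<lambda>x. c * f x) = c * \<phi> f"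
  by (simp add: bidual_def)

lemma bidual_sum:
  assumes \<phi>: "\<phi> \<in> bidual smul" and "finite F" "\<And>i. i \<in> F \<Longrightarrow> f i \<in> dual smul"
  shows "\<phi> (\<lambda>x. \<Sum>i\<in>F. c i * f i x) = (\<Sum>i\<in>F. c i * \<phi> (f i))"
  using assms(2,3)
proof (induction F rule: finite_induct)
  case empty
  have "(\<lambda>x. 0) \<in> dual smul" by (simp add: dual_def)
  from bidual_scale[OF \<phi> this, of 0] show ?case by simp
next
  case (insert i F)
  have "(\<lambda>x. c i * f i x) \<in> dual smul" using dual_sum[of "{i}" f c] insert.prems by simp
  moreover have "(\<lambda>x. \<Sum>i\<in>F. c i * f i x) \<in> dual smul" using dual_sum insert by auto
  ultimately show ?case
    using insert by (simp add: bidual_add[OF \<phi>] bidual_scale[OF \<phi>])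
qed

text \<open>
  Some \<open>M\<close> with \<open>wuc_bound y M\<close> exists iff \<open>\<Sum> y k\<close> is weakly unconditionally Cauchy.
\<close>

definition wuc_bound :: "(nat \<Rightarrow> 'a) \<Rightarrow> real \<Rightarrow> bool" where
  "wuc_bound y M \<longleftrightarrow> (\<forall>F a. finite F \<longrightarrow> (\<forall>k\<in>F. norm (a k) \<le> 1) \<longrightarrow> norm (\<Sum>k\<in>F. smul (a k) (y k)) \<le> M)"

lemma wuc_boundD:
  "wuc_bound y M \<Longrightarrow> finite F \<Longrightarrow> (\<And>k. k \<in> F \<Longrightarrow> norm (a k) \<le> 1) \<Longrightarrow> norm (\<Sum>k\<in>F. smul (a k) (y k)) \<le> M"
  unfolding wuc_bound_def by blast

lemma wuc_bound_nonneg: "wuc_bound y M \<Longrightarrow> 0 \<le> M"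
  using wuc_boundD[of y M "{}"] by simp

lemma wuc_bound_scaled:
  assumes y: "wuc_bound y M" and "finite F" "\<And>k. k \<in> F \<Longrightarrow> norm (a k) \<le> e" "0 \<le> e"
  shows "norm (\<Sum>k\<in>F. smul (a k) (y k)) \<le> M * e"
proof (cases "e = 0")
  case True
  then have "(\<Sum>k\<in>F. smul (a k) (y k)) = 0" using assms(3) by (intro sum.neutral) auto
  then show ?thesis using True by simp
next
  case False
  then have e: "e > 0" using assms by simp
  have "(\<Sum>k\<in>F. smul (a k) (y k)) = e *\<^sub>R (\<Sum>k\<in>F. smul (a k / of_real e) (y k))"
    using e by (simp add: scale_sum_right flip: smul_of_real)
  moreover have "norm (\<Sum>k\<in>F. smul (a k / of_real e) (y k)) \<le> M"
    using assms e by (intro wuc_boundD[OF y]) (auto simp: norm_divide)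
  ultimately show ?thesis using e by (simp add: mult.commute)
qed

lemma wuc_bound_subseq:
  assumes y: "wuc_bound y M" and r: "inj r"
  shows "wuc_bound (\<lambda>k. y (r k)) M"
  unfolding wuc_bound_def
proof (intro allI impI)
  fix F :: "nat set" and a :: "nat \<Rightarrow> 'k"
  assume F: "finite F" "\<forall>k\<in>F. norm (a k) \<le> 1"
  have "norm (\<Sum>k\<in>r ` F. smul (a (inv r k)) (y k)) \<le> M"
    using F r by (intro wuc_boundD[OF y]) auto
  then show "norm (\<Sum>k\<in>F. smul (a k) (y (r k))) \<le> M"
    using r by (simp add: sum.reindex inj_on_subset[OF r])
qed

text \<open>Multipliers rotate each \<open>g (y k)\<close> to its norm, so a sum of norms becomes
  the value of \<open>g\<close> at a single bounded-multiplier sum.\<close>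

lemma wuc_functional:
  assumes y: "wuc_bound y M" and g: "g \<in> dual smul"
  shows "summable (\<lambda>k. norm (g (y k)))" "(\<Sum>k. norm (g (y k))) \<le> onorm g * M"
proof -
  interpret g: bounded_linear g using g by (simp add: dual_def)
  have le: "(\<Sum>k\<in>F. norm (g (y k))) \<le> onorm g * M" if F: "finite F" for F
  proof -
    \<comment> \<open>Where \<open>g (y k) = 0\<close>, division by zero gives
      \<open>a k = 0\<close>, which is still admissible.\<close>
    define a where "a k = of_real (norm (g (y k))) / g (y k)" for k
    have "(\<Sum>k\<in>F. of_real (norm (g (y k)))) = (\<Sum>k\<in>F. a k * g (y k))"
      by (intro sum.cong) (auto simp: a_def)
    also have "\<dots> = g (\<Sum>k\<in>F. smul (a k) (y k))"
      using g by (simp add: g.sum dual_def)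
    finally have "norm (of_real (\<Sum>k\<in>F. norm (g (y k))) :: 'k) = norm (g (\<Sum>k\<in>F. smul (a k) (y k)))"
      by (simp only: of_real_sum)
    also have "\<dots> \<le> onorm g * norm (\<Sum>k\<in>F. smul (a k) (y k))"
      by (rule onorm[OF g.bounded_linear_axioms])
    also have "\<dots> \<le> onorm g * M"
      by (intro mult_left_mono onorm_pos_le[OF g.bounded_linear_axioms] wuc_boundD[OF y F])
        (auto simp: a_def norm_divide)
    finally show ?thesis by (simp add: sum_nonneg del: of_real_sum)
  qed
  show *: "summable (\<lambda>k. norm (g (y k)))"
    by (rule summableI_nonneg_bounded[where x = "onorm g * M"]) (simp_all add: le)
  show "(\<Sum>k. norm (g (y k))) \<le> onorm g * M"
    by (rule suminf_le_const[OF *]) (simp add: le)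
qed

text \<open>The tail coefficients of a null sequence are uniformly small, and by homogeneity of the
  multiplier bound so are the tail sums.\<close>

lemma wuc_c0_summable:
  assumes y: "wuc_bound y M" and a: "a \<in> c0"
  shows "summable (\<lambda>k. smul (a k) (y k))"
    and "norm (\<Sum>k. smul (a k) (y k)) \<le> M * sup_norm a"
proof -
  have M: "0 \<le> M" using wuc_bound_nonneg[OF y] .
  show *: "summable (\<lambda>k. smul (a k) (y k))"
    unfolding summable_Cauchy
  proof (intro allI impI)
    fix e :: real assume e: "0 < e"
    define d where "d = e / (M + 1)"
    have d: "0 < d" "M * d < e" using e M by (auto simp: d_def field_simps)
    obtain N where N: "\<And>k. k \<ge> N \<Longrightarrow> norm (a k) < d"
      using a d(1) by (auto simp: c0_def LIMSEQ_iff)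
    have "norm (\<Sum>k\<in>{m..<n}. smul (a k) (y k)) \<le> M * d" if "m \<ge> N" for m n
      using N that d by (intro wuc_bound_scaled[OF y]) (auto intro!: less_imp_le)
    then show "\<exists>N. \<forall>m\<ge>N. \<forall>n. norm (\<Sum>k\<in>{m..<n}. smul (a k) (y k)) < e"
      using d(2) by (meson le_less_trans)
  qed
  have le: "norm (\<Sum>k<n. smul (a k) (y k)) \<le> M * sup_norm a" for n
    using norm_le_sup_norm[OF a] order.trans[OF norm_ge_zero norm_le_sup_norm[OF a]]
    by (intro wuc_bound_scaled[OF y]) auto
  show "norm (\<Sum>k. smul (a k) (y k)) \<le> M * sup_norm a"
    by (rule Lim_bounded[OF tendsto_norm[OF summable_LIMSEQ[OF *]]]) (use le in blast)
qed

text \<open>A multiplier on the blocks is a multiplier on \<open>v\<close> that is constant on each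
  block.\<close>

lemma wuc_bound_blocks:
  assumes v: "wuc_bound v M" and b: "strict_mono b" and B: "\<And>k. B k \<subseteq> {b k..<b (Suc k)}"
  shows "wuc_bound (\<lambda>k. sum v (B k)) M"
  unfolding wuc_bound_def
proof (intro allI impI)
  fix F and a :: "nat \<Rightarrow> 'k"
  assume F: "finite F" "\<forall>k\<in>F. norm (a k) \<le> 1"
  note uniq = strict_mono_interval_unique[OF b]
  have fin: "finite (B k)" for k using B[of k] finite_subset by blast
  \<comment> \<open>Outside all blocks the value is arbitrary, but no such index enters the
    sum.\<close>
  define a' where "a' i = a (THE k. i \<in> B k)" for i
  have a': "a' i = a k" if "i \<in> B k" for i k
  proof -
    have "(THE k. i \<in> B k) = k" using that uniq B by blast
    then show ?thesis by (simp add: a'_def)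
  qed
  have "norm (\<Sum>i\<in>(\<Union>k\<in>F. B k). smul (a' i) (v i)) \<le> M"
    using F fin a' by (intro wuc_boundD[OF v]) auto
  also have "(\<Sum>i\<in>(\<Union>k\<in>F. B k). smul (a' i) (v i)) = (\<Sum>k\<in>F. \<Sum>i\<in>B k. smul (a' i) (v i))"
  proof (rule sum.UNION_disjoint)
    show "\<forall>k\<in>F. \<forall>l\<in>F. k \<noteq> l \<longrightarrow> B k \<inter> B l = {}" using uniq B by blast
  qed (use F fin in auto)
  also have "\<dots> = (\<Sum>k\<in>F. smul (a k) (sum v (B k)))"
    by (simp add: a' scale_sum_right)
  finally show "norm (\<Sum>k\<in>F. smul (a k) (sum v (B k))) \<le> M" .
qed

text \<open>The multiplier sum is the image of a finitely supported sequence of sup norm at most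
  1.\<close>

lemma wuc_bound_c0_basis:
  fixes T :: "(nat \<Rightarrow> 'k) \<Rightarrow> 'a"
  assumes add: "\<And>a b. a \<in> c0 \<Longrightarrow> b \<in> c0 \<Longrightarrow> T (\<lambda>i. a i + b i) = T a + T b"
    and scale: "\<And>c a. a \<in> c0 \<Longrightarrow> T (\<lambda>i. c * a i) = smul c (T a)"
    and le: "\<And>a. a \<in> c0 \<Longrightarrow> norm (T a) \<le> B * sup_norm a" and "0 \<le> B"
  shows "wuc_bound (\<lambda>k. T (\<lambda>i. if i = k then 1 else 0)) B"
  unfolding wuc_bound_def
proof (intro allI impI)
  fix F :: "nat set" and a :: "nat \<Rightarrow> 'k"
  assume F: "finite F" and a: "\<forall>k\<in>F. norm (a k) \<le> 1"
  have unit: "(\<lambda>i. if i = k then c else 0) \<in> c0" for k and c :: 'k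
    using finite_support_in_c0[of "{k}" "\<lambda>_. c"] by simp
  have "T (\<lambda>i. if i \<in> F then a i else 0) = (\<Sum>k\<in>F. smul (a k) (T (\<lambda>i. if i = k then 1 else 0)))"
    using F
  proof (induction F rule: finite_induct)
    case empty
    show ?case using scale[of "\<lambda>i. 0" 0] by (simp add: c0_def)
  next
    case (insert k F)
    have "T (\<lambda>i. if i \<in> insert k F then a i else 0)
        = T (\<lambda>i. (if i = k then a k else 0) + (if i \<in> F then a i else 0))"
      using insert.hyps by (intro arg_cong[where f = T]) auto
    also have "\<dots> = T (\<lambda>i. if i = k then a k else 0) + T (\<lambda>i. if i \<in> F then a i else 0)"
      using insert.hyps by (intro add unit finite_support_in_c0)
    also have "T (\<lambda>i. if i = k then a k else 0) = smul (a k) (T (\<lambda>i. if i = k then 1 else 0))"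
      using scale[OF unit[of k 1], of "a k"] by (simp add: if_distrib[of "\<lambda>x. a k * x"] cong: if_cong)
    finally show ?case using insert by simp
  qed
  moreover have "norm (T (\<lambda>i. if i \<in> F then a i else 0)) \<le> B * 1"
    using a F \<open>0 \<le> B\<close>
    by (intro order.trans[OF le mult_left_mono] finite_support_in_c0 sup_norm_le) auto
  ultimately show "norm (\<Sum>k\<in>F. smul (a k) (T (\<lambda>i. if i = k then 1 else 0))) \<le> B" by simp
qed

text \<open>The series of the \<open>y k\<close> need not converge in the space, but it converges
  absolutely under every functional; its weak sum is thus an element of the bidual.\<close>

lemma wuc_bidual:
  assumes y: "wuc_bound y M"
  shows "(\<lambda>g. \<Sum>k. g (y k)) \<in> bidual smul"
proof -
  have sm: "summable (\<lambda>k. g (y k))" if "g \<in> dual smul" for g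
    using wuc_functional(1)[OF y that] by (rule summable_of_summable_norm)
  have "norm (\<Sum>k. g (y k)) \<le> M * onorm g" if g: "g \<in> dual smul" for g
  proof (rule Lim_bounded[OF tendsto_norm[OF summable_LIMSEQ[OF sm[OF g]]]], intro allI impI)
    fix n
    have "norm (\<Sum>k<n. g (y k)) \<le> (\<Sum>k<n. norm (g (y k)))" by (rule norm_sum)
    also have "\<dots> \<le> (\<Sum>k. norm (g (y k)))"
      by (rule sum_le_suminf[OF wuc_functional(1)[OF y g]]) auto
    also have "\<dots> \<le> M * onorm g" using wuc_functional(2)[OF y g] by (simp add: mult.commute)
    finally show "norm (\<Sum>k<n. g (y k)) \<le> M * onorm g" .
  qed
  then show ?thesis
    unfolding bidual_def mem_Collect_eq
    by (intro conjI ballI allI exI[of _ M] suminf_add[symmetric] suminf_mult sm)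
qed

end

section \<open>Unconditional expansions\<close>

locale unconditional_expansion = banach_space_over smul
  for smul :: "'k::real_or_complex \<Rightarrow> 'a::banach \<Rightarrow> 'a" +
  fixes f :: "nat \<Rightarrow> 'a \<Rightarrow> 'k" and u :: "nat \<Rightarrow> 'a"
  assumes f_dual: "f i \<in> dual smul"
    and expansion: "(\<lambda>i. smul (f i x) (u i)) sums x"
    and unconditional: "unconditionally_summable (\<lambda>i. smul (f i x) (u i))"
begin

section \<open>Partial sum operators and uniform multiplier bounds\<close>

definition partial_sum :: "nat \<Rightarrow> 'a \<Rightarrow> 'a" where
  "partial_sum n x = (\<Sum>i<n. smul (f i x) (u i))"

lemma bounded_linear_f: "bounded_linear (f i)"
  using f_dual by (simp add: dual_def)

lemma f_smul: "f i (smul c x) = c * f i x"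
  using f_dual[of i] by (simp add: dual_def)

lemma bounded_linear_partial_sum: "bounded_linear (partial_sum n)"
  unfolding partial_sum_def[abs_def]
  by (intro bounded_linear_sum bounded_linear_compose[OF bounded_linear_smul_left bounded_linear_f])

lemma partial_sum_smul: "partial_sum n (smul c x) = smul c (partial_sum n x)"
  by (simp add: partial_sum_def f_smul scale_sum_right)

text \<open>Unconditionality bounds the finite subset sums pointwise, the uniform boundedness
  principle bounds them uniformly, and \<open>norm_sum_smul_le\<close> passes from subset sums to
  multipliers.\<close>

lemma multiplier_bound:
  obtains K where "0 \<le> K" "\<And>F a x. finite F \<Longrightarrow> (\<And>i. i \<in> F \<Longrightarrow> norm (a i) \<le> 1) \<Longrightarrow>
    norm (\<Sum>i\<in>F. smul (a i) (smul (f i x) (u i))) \<le> K * norm x"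
proof -
  have "\<exists>C. \<forall>F\<in>{F. finite F}. \<forall>x. norm (\<Sum>i\<in>F. smul (f i x) (u i)) \<le> C * norm x"
  proof (rule uniform_boundedness)
    show "bounded_linear (\<lambda>x. \<Sum>i\<in>F. smul (f i x) (u i))" for F
      by (intro bounded_linear_sum bounded_linear_compose[OF bounded_linear_smul_left bounded_linear_f])
    show "\<exists>C. \<forall>F\<in>{F. finite F}. norm (\<Sum>i\<in>F. smul (f i x) (u i)) \<le> C" for x
      using unconditionally_summable_bounded[OF unconditional[of x]] by simp
  qed
  then obtain C where C: "\<And>F x. finite F \<Longrightarrow> norm (\<Sum>i\<in>F. smul (f i x) (u i)) \<le> C * norm x"
    by blast
  show ?thesis
  proof (rule that[of "4 * max C 0"])
    fix F :: "nat set" and a :: "nat \<Rightarrow> 'k" and x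
    assume F: "finite F" and a: "\<And>i. i \<in> F \<Longrightarrow> norm (a i) \<le> 1"
    have "norm (\<Sum>i\<in>G. smul (f i x) (u i)) \<le> max C 0 * norm x" if "G \<subseteq> F" for G
      using C[of G x] finite_subset[OF that F] mult_right_mono[of C "max C 0" "norm x"] by simp
    from norm_sum_smul_le[OF F this a]
    show "norm (\<Sum>i\<in>F. smul (a i) (smul (f i x) (u i))) \<le> 4 * max C 0 * norm x"
      by (simp add: mult.assoc)
  qed simp
qed

text \<open>The multiplier bound is transferred to the bidual by duality: a norming \<open>G\<close>
  turns the sum into the value of \<open>\<phi>\<close> at a finite combination \<open>g\<close> of
  the \<open>f i\<close>, whose norm is controlled by \<open>K\<close>.\<close>

lemma wuc_bound_bidual:
  assumes \<phi>: "\<phi> \<in> bidual smul"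
  shows "\<exists>M. wuc_bound (\<lambda>i. smul (\<phi> (f i)) (u i)) M"
proof -
  obtain K where K: "0 \<le> K" "\<And>F a x. finite F \<Longrightarrow> (\<And>i. i \<in> F \<Longrightarrow> norm (a i) \<le> 1) \<Longrightarrow>
    norm (\<Sum>i\<in>F. smul (a i) (smul (f i x) (u i))) \<le> K * norm x"
    using multiplier_bound by blast
  have "\<exists>C. \<forall>g\<in>dual smul. norm (\<phi> g) \<le> C * onorm g"
    using \<phi> by (simp add: bidual_def)
  then obtain C0 where C0: "\<And>g. g \<in> dual smul \<Longrightarrow> norm (\<phi> g) \<le> C0 * onorm g"
    by blast
  define C where "C = max C0 0"
  have C: "norm (\<phi> g) \<le> C * onorm g" if g: "g \<in> dual smul" for g
    using C0[OF g] mult_right_mono[of C0 C "onorm g"] onorm_pos_le[of g] g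
    by (auto simp: C_def dual_def)
  have "norm (\<Sum>i\<in>F. smul (a i) (smul (\<phi> (f i)) (u i))) \<le> C * (2 * K)"
    if F: "finite F" and a: "\<And>i. i \<in> F \<Longrightarrow> norm (a i) \<le> 1" for F and a :: "nat \<Rightarrow> 'k"
  proof -
    obtain G where G_add: "\<And>x y. G (x + y) = G x + G y" and G_smul: "\<And>c x. G (smul c x) = c * G x"
      and G_ge: "norm (\<Sum>i\<in>F. smul (a i * \<phi> (f i)) (u i)) \<le> norm (G (\<Sum>i\<in>F. smul (a i * \<phi> (f i)) (u i)))"
      and G_le: "\<And>d. norm (G (\<Sum>i\<in>F. smul (d i) (u i))) \<le> 2 * norm (\<Sum>i\<in>F. smul (d i) (u i))"
      using norming_functional[OF F, of "\<lambda>i. a i * \<phi> (f i)" u] by blast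
    have G_0: "G 0 = 0" using G_smul[of 0 0] by simp
    have G_sum: "G (\<Sum>i\<in>F. smul (d i) (u i)) = (\<Sum>i\<in>F. d i * G (u i))" for d
      using sum_comp_morphism[of G "\<lambda>i. smul (d i) (u i)" F] by (simp add: G_0 G_add G_smul comp_def)
    \<comment> \<open>\<open>G\<close> itself need not be bounded, but \<open>g\<close> lies in the
      dual, and \<open>g x\<close> is \<open>G\<close> applied to a multiplier sum of the expansion
      of \<open>x\<close>.\<close>
    define g where "g x = (\<Sum>i\<in>F. (a i * G (u i)) * f i x)" for x
    have g: "g \<in> dual smul"
      unfolding g_def[abs_def] by (rule dual_sum[OF F f_dual])
    have "norm (g x) \<le> 2 * K * norm x" for x
    proof -
      have "g x = G (\<Sum>i\<in>F. smul (a i * f i x) (u i))"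
        by (simp add: g_def G_sum mult_ac)
      also have "norm \<dots> \<le> 2 * norm (\<Sum>i\<in>F. smul (a i * f i x) (u i))" by (rule G_le)
      also have "\<dots> \<le> 2 * (K * norm x)" using K(2)[where a = a and x = x, OF F a] by simp
      finally show ?thesis by simp
    qed
    then have "onorm g \<le> 2 * K" using K(1) by (intro onorm_bound) auto
    then have "C * onorm g \<le> C * (2 * K)" by (intro mult_left_mono) (auto simp: C_def)
    moreover have "G (\<Sum>i\<in>F. smul (a i * \<phi> (f i)) (u i)) = \<phi> g"
      unfolding g_def[abs_def] bidual_sum[OF \<phi> F f_dual] G_sum by (simp add: mult_ac)
    ultimately show ?thesis using G_ge C[OF g] by simp
  qed
  then show ?thesis unfolding wuc_bound_def by blast
qed

text \<open>Rows tend to 0 because each \<open>f i (y j)\<close> is absolutely summable in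
  \<open>j\<close>; columns converge by the expansion of \<open>y j\<close>.\<close>

lemma gliding_hump_wuc:
  assumes y: "wuc_bound y M" and "0 < \<eta>"
  obtains m r where "strict_mono m" "strict_mono r"
    "\<And>k i. norm (partial_sum (m (Suc k)) (y (r i)) - partial_sum (m k) (y (r i)) - (if i = k then y (r k) else 0)) \<le> \<eta> * (1/2)^i"
proof (rule gliding_hump[where S = "\<lambda>n j. partial_sum n (y j)" and y = y and \<eta> = \<eta>])
  show "(\<lambda>j. partial_sum n (y j)) \<longlonglongrightarrow> 0" for n
    unfolding partial_sum_def
  proof (rule tendsto_null_sum)
    fix i
    have "(\<lambda>j. f i (y j)) \<longlonglongrightarrow> 0"
      using summable_LIMSEQ_zero[OF wuc_functional(1)[OF y f_dual]] by (simp add: tendsto_norm_zero_iff)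
    then show "(\<lambda>j. smul (f i (y j)) (u i)) \<longlonglongrightarrow> 0"
      by (rule bounded_linear.tendsto_zero[OF bounded_linear_smul_left])
  qed
  show "(\<lambda>n. partial_sum n (y j)) \<longlonglongrightarrow> y j" for j
    using expansion[of "y j"] by (simp add: sums_def partial_sum_def)
qed (use assms that in blast)+

section \<open>Bounded completeness excludes copies of the null sequences\<close>

lemma boundedly_complete_imp_no_c0:
  assumes bc: "boundedly_complete smul f u"
  shows "\<not> contains_copy_of_c0 smul"
proof
  assume "contains_copy_of_c0 smul"
  then obtain T :: "(nat \<Rightarrow> 'k) \<Rightarrow> 'a" where
      add: "\<forall>a\<in>c0. \<forall>b\<in>c0. T (\<lambda>i. a i + b i) = T a + T b"
      and scale: "\<forall>c. \<forall>a\<in>c0. T (\<lambda>i. c * a i) = smul c (T a)"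
      and bounds: "\<exists>A>0. \<exists>B>0. \<forall>a\<in>c0. A * sup_norm a \<le> norm (T a) \<and> norm (T a) \<le> B * sup_norm a"
    unfolding contains_copy_of_c0_def by (elim exE conjE) (rule that, assumption+, blast)
  obtain A B where AB: "A > 0" "B > 0"
      and ge: "\<And>a. a \<in> c0 \<Longrightarrow> A * sup_norm a \<le> norm (T a)"
      and le: "\<And>a. a \<in> c0 \<Longrightarrow> norm (T a) \<le> B * sup_norm a"
    using bounds by blast
  define y where "y k = T (\<lambda>i. if i = k then 1 else 0)" for k
  have y: "wuc_bound y B"
    unfolding y_def[abs_def]
    by (rule wuc_bound_c0_basis) (use AB(2) in \<open>simp_all add: le add[rule_format] scale[rule_format]\<close>)
  have norm_y: "A \<le> norm (y k)" for k
  proof -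
    have e: "(\<lambda>i. if i = k then 1 else (0 :: 'k)) \<in> c0"
      using finite_support_in_c0[of "{k}" "\<lambda>_. 1 :: 'k"] by simp
    have "A * 1 \<le> A * sup_norm (\<lambda>i. if i = k then 1 else (0 :: 'k))"
      using norm_le_sup_norm[OF e, of k] AB(1) by (intro mult_left_mono) auto
    then show ?thesis using ge[OF e] by (simp add: y_def)
  qed
  \<comment> \<open>With \<open>A / 4\<close> the errors of one block add up to at most
    \<open>A / 2\<close>, half of the lower bound for \<open>norm (y k)\<close>.\<close>
  obtain m r where m: "strict_mono m" and r: "strict_mono r"
    and hump: "\<And>k i. norm (partial_sum (m (Suc k)) (y (r i)) - partial_sum (m k) (y (r i)) - (if i = k then y (r k) else 0)) \<le> A / 4 * (1/2)^i"
    using gliding_hump_wuc[OF y, of "A / 4"] AB(1) by auto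
  define z where "z = (\<lambda>k. y (r k))"
  have z: "wuc_bound z B"
    unfolding z_def using wuc_bound_subseq[OF y] r strict_mono_imp_inj_on by blast
  define \<phi> where "\<phi> g = (\<Sum>k. g (z k))" for g :: "'a \<Rightarrow> 'k"
  define X where "X n = (\<Sum>i<n. smul (\<phi> (f i)) (u i))" for n
  \<comment> \<open>The finite sum over coordinates is exchanged with the series defining
    \<open>\<phi>\<close>.\<close>
  have X: "(\<lambda>j. partial_sum n (z j)) sums X n" for n
    unfolding partial_sum_def X_def
  proof (rule sums_sum)
    fix i
    have "(\<lambda>j. f i (z j)) sums \<phi> (f i)"
      unfolding \<phi>_def
      by (rule summable_sums[OF summable_of_summable_norm[OF wuc_functional(1)[OF z f_dual]]])
    then show "(\<lambda>j. smul (f i (z j)) (u i)) sums smul (\<phi> (f i)) (u i)"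
      by (rule bounded_linear.sums[OF bounded_linear_smul_left])
  qed
  have "A / 2 \<le> norm (X (m (Suc k)) - X (m k))" for k
  proof -
    have "(\<lambda>j. partial_sum (m (Suc k)) (z j) - partial_sum (m k) (z j) - (if j = k then z k else 0)) sums
        (X (m (Suc k)) - X (m k) - z k)"
      using sums_single[of k z] by (intro sums_diff X) (simp cong: if_cong)
    then have "norm (X (m (Suc k)) - X (m k) - z k) \<le> 2 * (A / 4)"
      by (rule sums_norm_le) (unfold z_def, rule hump)
    moreover have "A \<le> norm (z k)" using norm_y by (simp add: z_def)
    ultimately show ?thesis
      using norm_triangle_ineq3[of "z k" "X (m (Suc k)) - X (m k)"] 
      by (simp add: norm_minus_commute abs_le_iff)
  qed
  moreover have "\<phi> \<in> bidual smul" unfolding \<phi>_def[abs_def] by (rule wuc_bidual[OF z])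
  then have "summable (\<lambda>i. smul (\<phi> (f i)) (u i))"
    using bc by (simp add: boundedly_complete_def)
  then obtain L where "X \<longlonglongrightarrow> L"
    unfolding X_def[abs_def] using summable_LIMSEQ by blast
  \<comment> \<open>Blocks of a convergent series tend to 0, contrary to the bound
    \<open>A / 2\<close>.\<close>
  then have "(\<lambda>k. X (m (Suc k)) - X (m k)) \<longlonglongrightarrow> L - L"
    using LIMSEQ_subseq_LIMSEQ[OF _ m]
    by (intro tendsto_diff LIMSEQ_Suc[where f = "\<lambda>k. X (m k)"]) (auto simp: comp_def)
  then have "(\<lambda>k. norm (X (m (Suc k)) - X (m k))) \<longlonglongrightarrow> 0"
    by (simp add: tendsto_norm_zero_iff)
  ultimately have "A / 2 \<le> 0"
    by (intro tendsto_lowerbound[of _ 0 sequentially "A / 2"]) auto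
  then show False using AB(1) by simp
qed

section \<open>Construction of a copy of the null sequences from divergence\<close>

lemma wuc_contains_c0:
  assumes y: "wuc_bound y M" and \<delta>: "0 < \<delta>" "\<And>k. \<delta> \<le> norm (y k)"
  shows "contains_copy_of_c0 smul"
proof -
  obtain K where K: "0 \<le> K" "\<And>F a x. finite F \<Longrightarrow> (\<And>i. i \<in> F \<Longrightarrow> norm (a i) \<le> 1) \<Longrightarrow>
    norm (\<Sum>i\<in>F. smul (a i) (smul (f i x) (u i))) \<le> K * norm x"
    using multiplier_bound by blast
  have partial_sum_le: "norm (partial_sum n x) \<le> K * norm x" for n x
    using K(2)[of "{..<n}" "\<lambda>_. 1" x] by (simp add: partial_sum_def)
  obtain m r where m: "strict_mono m" and r: "strict_mono r"
    and hump: "\<And>k i. norm (partial_sum (m (Suc k)) (y (r i)) - partial_sum (m k) (y (r i)) - (if i = k then y (r k) else 0)) \<le> \<delta> / 4 * (1/2)^i"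
    using gliding_hump_wuc[OF y, of "\<delta> / 4"] \<delta>(1) by auto
  define z where "z = (\<lambda>k. y (r k))"
  have z: "wuc_bound z M"
    unfolding z_def using wuc_bound_subseq[OF y] r strict_mono_imp_inj_on by blast
  have M: "0 \<le> M" by (rule wuc_bound_nonneg[OF y])
  define T where "T a = (\<Sum>k. smul (a k) (z k))" for a
  \<comment> \<open>The block operator \<open>D\<close> sends \<open>T a\<close> close to
    \<open>smul (a k) (z k)\<close>, with error at most \<open>\<delta> / 2 * sup_norm a\<close>,
    and multiplies norms by at most \<open>2 * K\<close>. This bounds every coefficient
    \<open>a k\<close>.\<close>
  have lower: "\<delta> / (4 * (K + 1)) * sup_norm a \<le> norm (T a)" if a: "a \<in> c0" for a
  proof -
    have s0: "0 \<le> sup_norm a" using order.trans[OF norm_ge_zero norm_le_sup_norm[OF a]] .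
    have "norm (a k) \<le> (2 * K * norm (T a) + \<delta> / 2 * sup_norm a) / \<delta>" for k
    proof -
      define D where "D x = partial_sum (m (Suc k)) x - partial_sum (m k) x" for x
      have D: "bounded_linear D"
        unfolding D_def[abs_def] by (intro bounded_linear_sub bounded_linear_partial_sum)
      have D_smul: "D (smul c x) = smul c (D x)" for c x
        by (simp add: D_def partial_sum_smul scale_right_diff_distrib)
      have "(\<lambda>j. D (smul (a j) (z j))) sums D (T a)"
        unfolding T_def using wuc_c0_summable(1)[OF z a]
        by (intro bounded_linear.sums[OF D] summable_sums)
      then have "(\<lambda>j. D (smul (a j) (z j)) - (if j = k then smul (a j) (z j) else 0)) sums
          (D (T a) - smul (a k) (z k))"
        by (intro sums_diff sums_single)
      then have "norm (D (T a) - smul (a k) (z k)) \<le> 2 * (\<delta> / 4 * sup_norm a)"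
      proof (rule sums_norm_le)
        fix i
        have "D (smul (a i) (z i)) - (if i = k then smul (a i) (z i) else 0)
            = smul (a i) (D (z i) - (if i = k then z k else 0))"
          by (simp add: D_smul scale_right_diff_distrib)
        also have "norm \<dots> \<le> sup_norm a * (\<delta> / 4 * (1/2)^i)"
          unfolding norm_smul using hump[of k i] norm_le_sup_norm[OF a, of i] s0
          by (intro mult_mono) (auto simp: D_def z_def)
        finally show "norm (D (smul (a i) (z i)) - (if i = k then smul (a i) (z i) else 0))
            \<le> \<delta> / 4 * sup_norm a * (1/2)^i" by (simp add: mult_ac)
      qed
      moreover have "norm (D (T a)) \<le> 2 * K * norm (T a)"
        unfolding D_def using norm_triangle_ineq4[of "partial_sum (m (Suc k)) (T a)" "partial_sum (m k) (T a)"]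
          partial_sum_le[of "m (Suc k)" "T a"] partial_sum_le[of "m k" "T a"] by simp
      moreover have "norm (smul (a k) (z k)) \<le> norm (D (T a)) + norm (D (T a) - smul (a k) (z k))"
        by (metis add.commute diff_add_cancel norm_minus_commute norm_triangle_sub)
      moreover have "norm (a k) * \<delta> \<le> norm (smul (a k) (z k))"
        unfolding norm_smul z_def by (intro mult_left_mono \<delta>) auto
      ultimately have "norm (a k) * \<delta> \<le> 2 * K * norm (T a) + \<delta> / 2 * sup_norm a" by simp
      then show ?thesis using \<delta>(1) by (simp add: pos_le_divide_eq)
    qed
    then have "sup_norm a \<le> (2 * K * norm (T a) + \<delta> / 2 * sup_norm a) / \<delta>"
      by (rule sup_norm_le)
    \<comment> \<open>The error term is half of the left side and is absorbed. Afterwards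
      \<open>K + 1\<close> replaces \<open>K\<close> to keep the constant positive.\<close>
    then have "\<delta> * sup_norm a \<le> 4 * (K * norm (T a))"
      using \<delta>(1) by (simp add: field_simps)
    also have "\<dots> \<le> norm (T a) * (4 * (K + 1))" by (simp add: algebra_simps)
    finally show ?thesis using K(1) by (simp add: pos_divide_le_eq)
  qed
  \<comment> \<open>\<open>M + 1\<close> because the upper constant must be positive and
    \<open>M\<close> may be 0.\<close>
  have upper: "norm (T a) \<le> (M + 1) * sup_norm a" if a: "a \<in> c0" for a
    using wuc_c0_summable(2)[OF z a] order.trans[OF norm_ge_zero norm_le_sup_norm[OF a]]
    by (auto simp: T_def distrib_right)
  have "T (\<lambda>i. a i + b i) = T a + T b" if "a \<in> c0" "b \<in> c0" for a b
    unfolding T_def scale_left_distrib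
    by (intro suminf_add[symmetric] wuc_c0_summable(1)[OF z] that)
  moreover have "T (\<lambda>i. c * a i) = smul c (T a)" if "a \<in> c0" for c a
    unfolding T_def scale_scale[symmetric]
    by (rule bounded_linear.suminf[OF bounded_linear_smul wuc_c0_summable(1)[OF z that], symmetric])
  moreover have "\<delta> / (4 * (K + 1)) > 0" "M + 1 > 0" using K(1) M \<delta>(1) by auto
  then have "\<exists>A>0. \<exists>B>0. \<forall>a\<in>c0. A * sup_norm a \<le> norm (T a) \<and> norm (T a) \<le> B * sup_norm a"
    using lower upper by blast
  ultimately show ?thesis unfolding contains_copy_of_c0_def by blast
qed

lemma no_c0_imp_boundedly_complete:
  assumes no_c0: "\<not> contains_copy_of_c0 smul"
  shows "boundedly_complete smul f u"
  unfolding boundedly_complete_def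
proof (intro ballI)
  fix \<phi> assume "\<phi> \<in> bidual smul"
  define v where "v i = smul (\<phi> (f i)) (u i)" for i
  obtain M where v: "wuc_bound v M"
    using wuc_bound_bidual[OF \<open>\<phi> \<in> bidual smul\<close>] unfolding v_def[abs_def] by blast
  have "summable v"
  proof (rule ccontr)
    assume "\<not> summable v"
    then obtain \<delta> where \<delta>: "\<delta> > 0" "\<And>N. \<exists>m\<ge>N. \<exists>n. \<delta> \<le> norm (sum v {m..<n})"
      unfolding summable_Cauchy by (meson not_le)
    have "\<exists>m n. N \<le> m \<and> N < n \<and> \<delta> \<le> norm (sum v {m..<n})" for N
    proof -
      obtain m n where mn: "m \<ge> N" "\<delta> \<le> norm (sum v {m..<n})" using \<delta>(2) by blast
      then have "m < n" using \<delta>(1) by (cases "m < n") auto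
      with mn show ?thesis by (intro exI[of _ m] exI[of _ n]) auto
    qed
    then obtain p q where pq: "\<And>N. N \<le> p N" "\<And>N. N < q N" "\<And>N. \<delta> \<le> norm (sum v {p N..<q N})"
      by metis
    \<comment> \<open>Iterating \<open>q\<close> from 0 separates the blocks:
      \<open>{p (b k)..<q (b k)}\<close> lies in \<open>{b k..<b (Suc k)}\<close>, because
      \<open>b (Suc k) = q (b k)\<close>.\<close>
    define b where "b k = (q ^^ k) 0" for k
    have b_Suc: "b (Suc k) = q (b k)" for k by (simp add: b_def)
    have b: "strict_mono b" by (simp add: strict_mono_Suc_iff b_Suc pq)
    have "wuc_bound (\<lambda>k. sum v {p (b k)..<q (b k)}) M"
      using pq(1) by (intro wuc_bound_blocks[OF v b]) (auto simp: b_Suc intro: order.trans)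
    from wuc_contains_c0[OF this \<delta>(1) pq(3)] no_c0 show False by blast
  qed
  then show "summable (\<lambda>i. smul (\<phi> (f i)) (u i))" by (simp add: v_def[abs_def])
qed

end

theorem theorem3p4:
  fixes smul :: "'k::real_or_complex \<Rightarrow> 'a::banach \<Rightarrow> 'a"
    and f :: "nat \<Rightarrow> 'a \<Rightarrow> 'k" and u :: "nat \<Rightarrow> 'a"
  assumes "banach_space_over smul"
    and "unconditional_atomic_decomposition smul f u"
  shows "boundedly_complete smul f u \<longleftrightarrow> \<not> contains_copy_of_c0 smul"
proof -
  interpret banach_space_over smul by fact
  interpret unconditional_expansion smul f u
  proof
    have *: "(\<forall>i. f i \<in> dual smul) \<and> (\<forall>x. (\<lambda>i. smul (f i x) (u i)) sums x)"
      using assms(2) unfolding unconditional_atomic_decomposition_def atomic_decomposition_def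
        atomic_decomposition_wrt_def by fast
    show "f i \<in> dual smul" "(\<lambda>i. smul (f i x) (u i)) sums x" for i x
      using * by simp_all
    show "unconditionally_summable (\<lambda>i. smul (f i x) (u i))" for x
      using assms(2) by (simp add: unconditional_atomic_decomposition_def)
  qed
  show ?thesis using boundedly_complete_imp_no_c0 no_c0_imp_boundedly_complete by blast
qed

end
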